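(* Let $(x^{(t)},y^{(t)})_{t\ge 0}$ be generated by the DSPDC algorithm (described in the context) with sample sizes $m\in\{1,\dots,n\}$ (dual) and $q\in\{1,\dots,p\}$ (primal). Let $\Lambda>0$ be any constant with $\Lambda\ge\Lambda_{q,m}$, and suppose the parameters $\theta$ and $\tau,\sigma>0$ are chosen so that $$\theta=\frac{p}{q}-\frac{p/q}{\sqrt{\frac{\Lambda}{\lambda\gamma n}}\frac{np}{mq}+\max\{\frac{n}{m},\frac{p}{q}\}},\qquad \tau\sigma=\frac{nmq}{4p\Lambda},\qquad \frac{p}{2q\lambda\tau}+\frac{p}{q}=\frac{n^2}{2m\gamma\sigma}+\frac{n}{m}.$$ Then for each $t\ge0$, $$\left(\frac{p}{2q\tau}+\frac{p\lambda}{q}\right)\mathbb{E}\|x^\star-x^{(t)}\|^2+\left(\frac{n}{4m\sigma}+\frac{\gamma}{m}\right)\mathbb{E}\|y^\star-y^{(t)}\|^2$$ $$\le\left(1-\frac{1}{\max\left\{\frac{p}{q},\frac{n}{m}\right\}+\sqrt{\frac{\Lambda}{\lambda\gamma n}}\frac{np}{mq}}\right)^t\left[\left(\frac{p}{2q\tau}+\frac{p\lambda}{q}\right)\|x^\star-x^{(0)}\|^2+\left(\frac{n}{2m\sigma}+\frac{\gamma}{m}\right)\|y^\star-y^{(0)}\|^2\right].$$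
   Context: Setting. Let $A\in\mathbb{R}^{n\times p}$ have rows $a_1^T,\dots,a_n^T$; $A_i$ denotes the $i$-th row and $A^j$ the $j$-th column, and for $I\subset\{1,\dots,n\}$, $J\subset\{1,\dots,p\}$, $A_I^J$ is the submatrix with rows in $I$ and columns in $J$. Let $\lambda,\gamma>0$. Let $g(x)=\sum_{j=1}^p g_j(x_j)$, where each $g_j:\mathbb{R}\to\mathbb{R}$ is $\lambda$-strongly convex: $g_j(\alpha)\ge g_j(\beta)+g_j'(\beta)(\alpha-\beta)+\frac{\lambda}{2}(\alpha-\beta)^2$ for all $\alpha,\beta\in\mathbb{R}$ ($g_j'(\beta)$ a subgradient). Each $\phi_i:\mathbb{R}\to\mathbb{R}$, $i=1,\dots,n$, is convex, differentiable and $(1/\gamma)$-smooth: $\phi_i(\alpha)\le\phi_i(\beta)+\nabla\phi_i(\beta)(\alpha-\beta)+\frac{1}{2\gamma}(\alpha-\beta)^2$ for all $\alpha,\beta$. The convex conjugates are $\phi_i^*(\alpha)=\sup_{\beta\in\mathbb{R}}\{\alpha\beta-\phi_i(\beta)\}$ (possibly $+\infty$) and $g^*(v)=\sup_u\{\langle u,v\rangle-g(u)\}$. Primal objective: $P(x)=\frac1n\sum_{i=1}^n\phi_i(a_i^Tx)+g(x)$, minimized over $\mathbb{R}^p$ at $x^\star$. Dual objective: $D(y)=-g^*(-A^Ty/n)-\frac1n\sum_{i=1}^n\phi_i^*(y_i)$, maximized over $\mathbb{R}^n$ at $y^\star$. The pair $(x^\star,y^\star)$ is the saddle point of $\min_x\max_y\{g(x)+\frac1n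 y^TAx-\frac1n\sum_i\phi_i^*(y_i)\}$. $\|\cdot\|$ is the Euclidean norm of vectors, $\|\cdot\|_2$ the spectral norm of matrices, and $\Lambda_{q,m}=\max\{\|A_I^J\|_2^2: I\subset\{1,\dots,n\},J\subset\{1,\dots,p\},|I|=m,|J|=q\}$. DSPDC algorithm. Start from deterministic $x^{(-1)}=x^{(0)}=\bar x^{(0)}\in\mathbb{R}^p$, $y^{(-1)}=y^{(0)}=\bar y^{(0)}\in\mathbb{R}^n$, with parameters $(\theta,\tau,\sigma)$. For $t=0,1,2,\dots$: draw uniformly at random $I\subset\{1,\dots,n\}$ with $|I|=m$ and $J\subset\{1,\dots,p\}$ with $|J|=q$ (independent of each other and of the past), and set - $y_i^{(t+1)}=\arg\max_{\beta\in\mathbb{R}}\{\frac1n\langle A_i,\bar x^{(t)}\rangle\beta-\frac{\phi_i^*(\beta)}{n}-\frac{1}{2\sigma}(\beta-y_i^{(t)})^2\}$ if $i\in I$, and $y_i^{(t+1)}=y_i^{(t)}$ if $i\notin I$; - $\bar y^{(t+1)}=y^{(t)}+\frac nm(y^{(t+1)}-y^{(t)})$; - $x_j^{(t+1)}=\arg\min_{\alpha\in\mathbb{R}}\{\frac1n\langle A^j,\bar y^{(t+1)}\rangle\alpha+g_j(\alpha)+\frac{1}{2\tau}(\alpha-x_j^{(t)})^2\}$ if $j\in J$, and $x_j^{(t+1)}=x_j^{(t)}$ if $j\notin J$; - $\bar x^{(t+1)}=x^{(t)}+(\theta+1)(x^{(t+1)}-x^{(t)})$. $\mathbb{E}$ is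 expectation over all random draws. *)

theory Defs
  imports "HOL-Probability.Probability" "HOL-Library.Monad_Syntax"
begin

definition subdifferential :: "(real \<Rightarrow> real) \<Rightarrow> real \<Rightarrow> real set" where
  "subdifferential h b = {s. \<forall>a. h a \<ge> h b + s * (a - b)}"

definition strongly_convex :: "real \<Rightarrow> (real \<Rightarrow> real) \<Rightarrow> bool" where
  "strongly_convex lam h \<longleftrightarrow>
     (\<exists>h'. (\<forall>b. h' b \<in> subdifferential h b) \<and>
           (\<forall>a b. h a \<ge> h b + h' b * (a - b) + lam / 2 * (a - b)\<^sup>2))"

definition smooth_with :: "real \<Rightarrow> (real \<Rightarrow> real) \<Rightarrow> bool" where
  "smooth_with L h \<longleftrightarrow>
     (\<forall>b. h differentiable at b) \<and>
     (\<forall>a b. h a \<le> h b + deriv h b * (a - b) + L / 2 * (a - b)\<^sup>2)"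

(* The conjugate may take the value +\<infinity>, hence ereal.  On the type real the inner product is
   multiplication, so this also covers the scalar conjugates. *)
definition convex_conjugate :: "('a::real_inner \<Rightarrow> real) \<Rightarrow> 'a \<Rightarrow> ereal" where
  "convex_conjugate h v = (SUP u. ereal (u \<bullet> v - h u))"

definition separable_sum :: "('p \<Rightarrow> real \<Rightarrow> real) \<Rightarrow> real^'p::finite \<Rightarrow> real" where
  "separable_sum g x = (\<Sum>j\<in>UNIV. g j (x $ j))"

definition primal_obj ::
    "real^'p::finite^'n::finite \<Rightarrow> ('n \<Rightarrow> real \<Rightarrow> real) \<Rightarrow> ('p \<Rightarrow> real \<Rightarrow> real) \<Rightarrow> real^'p \<Rightarrow> real" where
  "primal_obj A \<phi> g x =
     1 / real CARD('n) * (\<Sum>i\<in>UNIV. \<phi> i (row i A \<bullet> x)) + separable_sum g x"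

(* Neither conjugate takes the value -\<infinity> (both functions are finite-valued), so the minuend is
   < +\<infinity>, the subtrahend is > -\<infinity>, and no undefined form \<infinity> - \<infinity> arises. *)
definition dual_obj ::
    "real^'p::finite^'n::finite \<Rightarrow> ('n \<Rightarrow> real \<Rightarrow> real) \<Rightarrow> ('p \<Rightarrow> real \<Rightarrow> real) \<Rightarrow> real^'n \<Rightarrow> ereal" where
  "dual_obj A \<phi> g y =
     - convex_conjugate (separable_sum g) (- (1 / real CARD('n)) *\<^sub>R (transpose A *v y))
     - ereal (1 / real CARD('n)) * (\<Sum>i\<in>UNIV. convex_conjugate (\<phi> i) (y $ i))"

(* The submatrix with rows in I and columns in J, padded with zeros to full size;
   padding does not change the spectral norm. *)
definition submat :: "real^'p::finite^'n::finite \<Rightarrow> 'n set \<Rightarrow> 'p set \<Rightarrow> real^'p^'n" where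
  "submat A I J = (\<chi> i j. if i \<in> I \<and> j \<in> J then A $ i $ j else 0)"

definition spectral_norm :: "real^'p::finite^'n::finite \<Rightarrow> real" where
  "spectral_norm B = onorm (\<lambda>u. B *v u)"

definition max_block_norm_sq :: "real^'p::finite^'n::finite \<Rightarrow> nat \<Rightarrow> nat \<Rightarrow> real" where
  "max_block_norm_sq A q m =
     Max {(spectral_norm (submat A I J))\<^sup>2 | I J. card I = m \<and> card J = q}"

type_synonym ('n, 'p) dspdc_state = "(real^'p) \<times> (real^'n) \<times> (real^'p)"

(* One iteration with the drawn index sets I, J; the state is the triple of x, y and the
   extrapolated x.  Both coordinate subproblems have a unique optimizer for the functions
   considered, so the choice made by arg_max and arg_min is immaterial. *)
definition dspdc_step ::
    "real^'p::finite^'n::finite \<Rightarrow> ('n \<Rightarrow> real \<Rightarrow> real) \<Rightarrow> ('p \<Rightarrow> real \<Rightarrow> real) \<Rightarrow>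
     real \<Rightarrow> real \<Rightarrow> real \<Rightarrow> nat \<Rightarrow> 'n set \<Rightarrow> 'p set \<Rightarrow>
     ('n, 'p) dspdc_state \<Rightarrow> ('n, 'p) dspdc_state" where
  "dspdc_step A \<phi> g \<theta> \<tau> \<sigma> m I J = (\<lambda>(x, y, xbar).
     let n = real CARD('n);
         y' = (\<chi> i. if i \<in> I
                 then arg_max (\<lambda>\<beta>. ereal (1 / n * (row i A \<bullet> xbar) * \<beta>)
                          - convex_conjugate (\<phi> i) \<beta> / ereal n
                          - ereal (1 / (2 * \<sigma>) * (\<beta> - y $ i)\<^sup>2)) (\<lambda>_. True)
                 else y $ i);
         ybar' = y + (n / real m) *\<^sub>R (y' - y);
         x' = (\<chi> j. if j \<in> J
                 then arg_min (\<lambda>\<alpha>. 1 / n * (column j A \<bullet> ybar') * \<alpha> + g j \<alpha>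
                          + 1 / (2 * \<tau>) * (\<alpha> - x $ j)\<^sup>2) (\<lambda>_. True)
                 else x $ j);
         xbar' = x + (\<theta> + 1) *\<^sub>R (x' - x)
     in (x', y', xbar'))"

(* Law of the state after t iterations; each iteration makes fresh independent draws. *)
primrec dspdc ::
    "real^'p::finite^'n::finite \<Rightarrow> ('n \<Rightarrow> real \<Rightarrow> real) \<Rightarrow> ('p \<Rightarrow> real \<Rightarrow> real) \<Rightarrow>
     real \<Rightarrow> real \<Rightarrow> real \<Rightarrow> nat \<Rightarrow> nat \<Rightarrow> real^'p \<Rightarrow> real^'n \<Rightarrow>
     nat \<Rightarrow> ('n, 'p) dspdc_state pmf" where
  "dspdc A \<phi> g \<theta> \<tau> \<sigma> m q x0 y0 0 = return_pmf (x0, y0, x0)"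
| "dspdc A \<phi> g \<theta> \<tau> \<sigma> m q x0 y0 (Suc t) = do {
     s \<leftarrow> dspdc A \<phi> g \<theta> \<tau> \<sigma> m q x0 y0 t;
     I \<leftarrow> pmf_of_set {I. card I = m};
     J \<leftarrow> pmf_of_set {J. card J = q};
     return_pmf (dspdc_step A \<phi> g \<theta> \<tau> \<sigma> m I J s)
   }"

end

theory Submission
  imports Defs
begin

text \<open>Optimality of the two proximal subproblems and of the saddle point, strong convexity of \<open>g\<close> and
  cocoercivity of the gradients of the \<open>\<phi> i\<close> give, after averaging over the random blocks, a descent
  inequality for each half-step. Adding the two, the bilinear terms telescope up to products of the
  increments of \<open>x\<close> and \<open>y\<close>. These increments are supported on sampled blocks, so the products are
  bounded through \<open>\<Lambda>\<close> and absorbed by the quadratic terms, exactly because of the choice of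
  \<open>\<tau> * \<sigma>\<close>. The quantity that contracts is
  \<open>Cx |xs - x|^2 + Cy |ys - y|^2 + p/(qn) <y - ys, A d> + p/(4 q \<tau>) |d|^2\<close>, where \<open>d\<close> is the last
  increment of \<open>x\<close> and \<open>Cx\<close>, \<open>Cy\<close> are the coefficients on the right-hand side of the theorem. The
  balance condition on \<open>\<tau>\<close> and \<open>\<sigma>\<close> makes its two sides at most the reciprocal of one minus the
  contraction factor.\<close>

section \<open>Scalar convex analysis\<close>

lemma smooth_with_above_tangent:
  assumes "convex_on UNIV h" "smooth_with L h"
  shows "h u \<ge> h a + deriv h a * (u - a)"
proof -
  have "h differentiable (at a)"
    using assms(2) unfolding smooth_with_def by blast
  then have "(h has_field_derivative deriv h a) (at a)"
    using DERIV_deriv_iff_real_differentiable by blast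
  then have "h u - h a \<ge> deriv h a * (u - a)"
    by (intro convex_on_imp_above_tangent[OF assms(1)]) auto
  then show ?thesis by simp
qed

text \<open>The tangent at \<open>a\<close> and the quadratic upper bound at \<open>b\<close> are
  compared at one common point; adding the mirror image of the result cancels the function
  values.\<close>

lemma smooth_with_cocoercive:
  assumes "\<gamma> > 0" "convex_on UNIV h" "smooth_with (1 / \<gamma>) h"
  shows "(deriv h a - deriv h b) * (a - b) \<ge> \<gamma> * (deriv h a - deriv h b)\<^sup>2"
proof -
  have *: "h a + deriv h a * (b - a) + \<gamma> / 2 * (deriv h a - deriv h b)\<^sup>2 \<le> h b" for a b
  proof -
    define d where "d = deriv h a - deriv h b"
    \<comment> \<open>At \<open>b + \<gamma> * d\<close> the gap between the quadratic upper bound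
      based at \<open>b\<close> and the tangent at \<open>a\<close> is smallest, which gives the
      strongest comparison.\<close>
    have "h (b + \<gamma> * d) \<ge> h a + deriv h a * (b + \<gamma> * d - a)"
      by (rule smooth_with_above_tangent) fact+
    moreover have "h (b + \<gamma> * d) \<le> h b + deriv h b * (b + \<gamma> * d - b) + 1 / \<gamma> / 2 * (b + \<gamma> * d - b)\<^sup>2"
      using assms(3) unfolding smooth_with_def by blast
    moreover have "1 / \<gamma> / 2 * (b + \<gamma> * d - b)\<^sup>2 = \<gamma> / 2 * d\<^sup>2"
      using \<open>\<gamma> > 0\<close> by (simp add: power2_eq_square)
    moreover have "deriv h a * (\<gamma> * d) - deriv h b * (\<gamma> * d) = \<gamma> * d\<^sup>2"
      by (simp add: d_def power2_eq_square algebra_simps)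
    ultimately show ?thesis by (simp add: d_def[symmetric] algebra_simps)
  qed
  have "(deriv h b - deriv h a)\<^sup>2 = (deriv h a - deriv h b)\<^sup>2"
    by (rule power2_commute)
  with *[of a b] *[of b a] show ?thesis by (simp add: algebra_simps)
qed

text \<open>Supplies continuity of the derivative for the intermediate value argument behind the
  dual step.\<close>

lemma smooth_with_deriv_lipschitz:
  assumes "\<gamma> > 0" "convex_on UNIV h" "smooth_with (1 / \<gamma>) h"
  shows "\<bar>deriv h a - deriv h b\<bar> \<le> \<bar>a - b\<bar> / \<gamma>"
proof (cases "deriv h a = deriv h b")
  case False
  have "\<gamma> * (deriv h a - deriv h b)\<^sup>2 \<le> \<bar>(deriv h a - deriv h b) * (a - b)\<bar>"
    using smooth_with_cocoercive[OF assms, of a b] abs_ge_self by (rule order_trans)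
  then have "(\<gamma> * \<bar>deriv h a - deriv h b\<bar>) * \<bar>deriv h a - deriv h b\<bar>
      \<le> \<bar>a - b\<bar> * \<bar>deriv h a - deriv h b\<bar>"
    by (simp only: abs_mult power2_eq_square abs_mult_self_eq mult_ac)
  then have "\<gamma> * \<bar>deriv h a - deriv h b\<bar> \<le> \<bar>a - b\<bar>"
    by (rule mult_right_le_imp_le) (use False in simp)
  then show ?thesis
    using \<open>\<gamma> > 0\<close> by (simp add: pos_le_divide_eq mult.commute)
qed (use \<open>\<gamma> > 0\<close> in simp)

lemma smooth_with_subgradient_unique:
  assumes "smooth_with L h" "\<And>z. h z \<ge> h a + s * (z - a)"
  shows "s = deriv h a"
proof -
  have "h differentiable (at a)"
    using assms(1) unfolding smooth_with_def by blast
  then have D: "(h has_field_derivative deriv h a) (at a)"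
    using DERIV_deriv_iff_real_differentiable by blast
  have "((\<lambda>z. h z - s * z) has_field_derivative deriv h a - s) (at a)"
    by (rule derivative_eq_intros D refl | simp)+
  then have "deriv h a - s = 0"
    by (rule DERIV_local_min[where d = 1]) (use assms(2) in \<open>auto simp: algebra_simps\<close>)
  then show ?thesis by simp
qed

section \<open>Convex conjugates and the dual proximal step\<close>

lemma convex_conjugate_ge: "convex_conjugate h v \<ge> ereal (u \<bullet> v - h u)"
  unfolding convex_conjugate_def by (rule SUP_upper) simp

lemma convex_conjugate_attained:
  assumes "\<And>u. u \<bullet> v - h u \<le> w \<bullet> v - h w"
  shows "convex_conjugate h v = ereal (w \<bullet> v - h w)"
  by (rule antisym[OF _ convex_conjugate_ge])
    (auto simp: convex_conjugate_def assms intro: SUP_least)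

text \<open>By Fenchel's equality the maximizer is the derivative of the smooth function at the point
  \<open>z\<close> solving the implicit equation below, so no regularity of the conjugate is needed.\<close>

lemma arg_max_conjugate_prox:
  fixes h :: "real \<Rightarrow> real"
  assumes "\<gamma> > 0" "\<sigma> > 0" "n > 0" "convex_on UNIV h" "smooth_with (1 / \<gamma>) h"
  obtains z where
    "arg_max (\<lambda>\<beta>. ereal (1 / n * w * \<beta>) - convex_conjugate h \<beta> / ereal n
       - ereal (1 / (2 * \<sigma>) * (\<beta> - y)\<^sup>2)) (\<lambda>_. True) = deriv h z"
    "z = w - n / \<sigma> * (deriv h z - y)"
proof -
  define F where "F = (\<lambda>z. z + n / \<sigma> * deriv h z)"
  have mono: "F b - F a \<ge> b - a" if "a \<le> b" for a b
  proof (cases "a = b")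
    case False
    have "0 \<le> \<gamma> * (deriv h b - deriv h a)\<^sup>2"
      using \<open>\<gamma> > 0\<close> by simp
    also have "\<dots> \<le> (deriv h b - deriv h a) * (b - a)"
      by (rule smooth_with_cocoercive) fact+
    finally have "deriv h b \<ge> deriv h a"
      using that False by (simp add: zero_le_mult_iff)
    then have "n / \<sigma> * (deriv h b - deriv h a) \<ge> 0"
      using assms by simp
    then show ?thesis by (simp add: F_def algebra_simps)
  qed simp
  have "(1 / \<gamma>)-lipschitz_on UNIV (deriv h)"
    by (rule lipschitz_onI)
      (use smooth_with_deriv_lipschitz[OF assms(1,4,5)] \<open>\<gamma> > 0\<close> in \<open>auto simp: dist_real_def\<close>)
  then have "continuous_on UNIV (deriv h)"
    by (rule lipschitz_on_continuous_on)
  then have contF: "continuous_on S F" for S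
    unfolding F_def by (intro continuous_intros) (auto intro: continuous_on_subset)
  \<comment> \<open>The equation \<open>F z = c\<close> is the stationarity condition of the dual
    subproblem. Since \<open>F\<close> grows at least as fast as the identity, a solution lies
    within distance \<open>r\<close> of 0.\<close>
  define c where "c = w + n / \<sigma> * y"
  define r where "r = \<bar>c - F 0\<bar>"
  have "F (- r) \<le> c" "c \<le> F r"
    using mono[of "-r" 0] mono[of 0 r] unfolding r_def by linarith+
  then obtain z where z: "F z = c"
    using IVT'[of F "-r" c r] contF[of "{-r..r}"] by (auto simp: r_def)
  then have zeq: "z = w - n / \<sigma> * (deriv h z - y)"
    by (simp add: F_def c_def algebra_simps)
  let ?obj = "\<lambda>\<beta>. ereal (1 / n * w * \<beta>) - convex_conjugate h \<beta> / ereal n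
       - ereal (1 / (2 * \<sigma>) * (\<beta> - y)\<^sup>2)"
  define \<beta>0 where "\<beta>0 = deriv h z"
  define v where "v = 1 / n * w * \<beta>0 - (z * \<beta>0 - h z) / n - 1 / (2 * \<sigma>) * (\<beta>0 - y)\<^sup>2"
  have "convex_conjugate h \<beta>0 = ereal (z * \<beta>0 - h z)"
    using smooth_with_above_tangent[OF assms(4,5), of z]
    by (subst convex_conjugate_attained[of _ _ z]) (auto simp: \<beta>0_def algebra_simps)
  then have at0: "?obj \<beta>0 = ereal v"
    using \<open>n > 0\<close> by (simp add: v_def)
  \<comment> \<open>Fenchel's inequality at \<open>z\<close> bounds the objective by a concave
    parabola. The equation for \<open>z\<close> puts its vertex at \<open>\<beta>0\<close>, where
    the bound is attained, so the maximizer exists and is unique.\<close>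
  have below: "?obj \<beta> \<le> ereal (v - 1 / (2 * \<sigma>) * (\<beta> - \<beta>0)\<^sup>2)" for \<beta>
  proof -
    have "ereal (z * \<beta> - h z) / ereal n \<le> convex_conjugate h \<beta> / ereal n"
      using convex_conjugate_ge[of z \<beta> h] \<open>n > 0\<close> by (intro ereal_divide_right_mono) auto
    then have "?obj \<beta> \<le> ereal (1 / n * w * \<beta>) - ereal (z * \<beta> - h z) / ereal n
       - ereal (1 / (2 * \<sigma>) * (\<beta> - y)\<^sup>2)"
      by (intro ereal_minus_mono order_refl)
    also have "\<dots> = ereal (1 / n * w * \<beta> - (z * \<beta> - h z) / n - 1 / (2 * \<sigma>) * (\<beta> - y)\<^sup>2)"
      using \<open>n > 0\<close> by simp
    also have "1 / n * w * \<beta> - (z * \<beta> - h z) / n - 1 / (2 * \<sigma>) * (\<beta> - y)\<^sup>2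
        = v - 1 / (2 * \<sigma>) * (\<beta> - \<beta>0)\<^sup>2"
    proof -
      have w: "w = z + n / \<sigma> * (\<beta>0 - y)"
        using zeq by (simp add: \<beta>0_def)
      show ?thesis
        unfolding v_def w using \<open>n > 0\<close> \<open>\<sigma> > 0\<close>
        by (simp add: field_simps power2_eq_square)
    qed
    finally show ?thesis .
  qed
  have "arg_max ?obj (\<lambda>_. True) = \<beta>0"
  proof (rule arg_maxI[where f = ?obj])
    fix \<beta>
    have "?obj \<beta> \<le> ?obj \<beta>0"
      unfolding at0 by (rule order_trans[OF below]) (use \<open>\<sigma> > 0\<close> in simp)
    then show "\<not> ?obj \<beta>0 < ?obj \<beta>" by (rule leD)
  next
    fix \<beta> assume "\<forall>\<beta>'. True \<longrightarrow> \<not> ?obj \<beta> < ?obj \<beta>'"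
    then have "\<not> ?obj \<beta> < ?obj \<beta>0" by blast
    then have "ereal v \<le> ?obj \<beta>" unfolding at0 by (rule leI)
    then have "ereal v \<le> ereal (v - 1 / (2 * \<sigma>) * (\<beta> - \<beta>0)\<^sup>2)"
      using below by (rule order_trans)
    then show "\<beta> = \<beta>0"
      using \<open>\<sigma> > 0\<close> by (simp add: divide_le_0_iff)
  qed simp
  then show ?thesis
    unfolding \<beta>0_def using zeq by (rule that)
qed

section \<open>Strong convexity and the primal proximal step\<close>

lemma strongly_convex_minimizer_growth:
  assumes "strongly_convex \<mu> h" "\<And>u. h b \<le> h u"
  shows "h a \<ge> h b + \<mu> / 2 * (a - b)\<^sup>2"
proof -
  obtain h' where h': "\<And>a b. h a \<ge> h b + h' b * (a - b) + \<mu> / 2 * (a - b)\<^sup>2"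
    using assms(1) unfolding strongly_convex_def by blast
  \<comment> \<open>The chosen subgradient \<open>h' b\<close> need not vanish at the minimizer, so
    the bound is first proved along the segment from \<open>b\<close> to \<open>a\<close>, with a
    loss \<open>1 - e\<close> that disappears in the limit.\<close>
  have *: "h a - h b \<ge> \<mu> / 2 * (1 - e) * (a - b)\<^sup>2" if "0 < e" "e < 1" for e
  proof -
    define c where "c = (1 - e) * b + e * a"
    have "e * (h c + h' c * (a - c) + \<mu> / 2 * (a - c)\<^sup>2) \<le> e * h a"
      "(1 - e) * (h c + h' c * (b - c) + \<mu> / 2 * (b - c)\<^sup>2) \<le> (1 - e) * h b"
      using h' that by (auto intro!: mult_left_mono)
    \<comment> \<open>The linear parts cancel because \<open>c\<close> is the weighted mean; the
      quadratic weights combine as e(1-e)^2 + (1-e)e^2 = e(1-e).\<close>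
    moreover have "e * (h c + h' c * (a - c) + \<mu> / 2 * (a - c)\<^sup>2)
        + (1 - e) * (h c + h' c * (b - c) + \<mu> / 2 * (b - c)\<^sup>2)
        = h c + e * (\<mu> / 2 * (1 - e) * (a - b)\<^sup>2)"
    proof -
      have c: "a - c = (1 - e) * (a - b)" "b - c = - e * (a - b)"
        by (simp_all add: c_def algebra_simps)
      show ?thesis
        unfolding c by (simp add: field_simps power2_eq_square)
    qed
    moreover have "h b \<le> h c" by fact
    ultimately have "e * (\<mu> / 2 * (1 - e) * (a - b)\<^sup>2) \<le> e * (h a - h b)"
      by (simp add: algebra_simps)
    then show ?thesis using that by simp
  qed
  have "((\<lambda>e. \<mu> / 2 * (1 - e) * (a - b)\<^sup>2) \<longlongrightarrow> \<mu> / 2 * (1 - 0) * (a - b)\<^sup>2) (at_right 0)"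
    by (intro tendsto_intros)
  moreover have "\<forall>\<^sub>F e in at_right 0. \<mu> / 2 * (1 - e) * (a - b)\<^sup>2 \<le> h a - h b"
    by (rule eventually_mono[OF eventually_at_right_real[of 0 1]]) (use * in auto)
  ultimately have "\<mu> / 2 * (1 - 0) * (a - b)\<^sup>2 \<le> h a - h b"
    by (intro tendsto_upperbound) auto
  then show ?thesis by simp
qed

lemma strongly_convex_imp_convex_on:
  assumes "strongly_convex \<mu> h" "\<mu> \<ge> 0"
  shows "convex_on UNIV h"
proof (rule convex_onI)
  fix t x y :: real
  assume t: "0 < t" "t < 1"
  define c where "c = (1 - t) * x + t * y"
  obtain s where s: "\<And>a. h a \<ge> h c + s * (a - c)"
    using assms(1) unfolding strongly_convex_def subdifferential_def by blast
  have "(1 - t) * (h c + s * (x - c)) \<le> (1 - t) * h x" "t * (h c + s * (y - c)) \<le> t * h y"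
    using s t by (auto intro!: mult_left_mono)
  moreover have "(1 - t) * (h c + s * (x - c)) + t * (h c + s * (y - c)) = h c"
  proof -
    have c: "x - c = t * (x - y)" "y - c = - (1 - t) * (x - y)"
      by (simp_all add: c_def algebra_simps)
    show ?thesis
      unfolding c by (simp add: algebra_simps)
  qed
  ultimately show "h ((1 - t) *\<^sub>R x + t *\<^sub>R y) \<le> (1 - t) * h x + t * h y"
    by (simp add: c_def)
qed simp

lemma strongly_convex_attains_min:
  assumes "strongly_convex \<mu> h" "\<mu> > 0"
  obtains b where "\<And>u. h b \<le> h u"
proof -
  obtain s where s: "\<And>a. h a \<ge> h 0 + s * (a - 0) + \<mu> / 2 * (a - 0)\<^sup>2"
    using assms(1) unfolding strongly_convex_def by blast
  \<comment> \<open>Beyond this radius the quadratic term dominates \<open>s * u\<close>, so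
    \<open>h\<close> is at least \<open>h 0\<close> there and a minimum over the compact interval is
    global.\<close>
  define r where "r = 2 * \<bar>s\<bar> / \<mu>"
  have "r \<ge> 0" using assms by (simp add: r_def)
  have "continuous_on {-r..r} h"
    by (rule continuous_on_subset[OF convex_on_continuous[of UNIV]])
      (use strongly_convex_imp_convex_on[OF assms(1)] assms(2) in auto)
  moreover have "compact {-r..r}" "{-r..r} \<noteq> {}"
    using \<open>r \<ge> 0\<close> by auto
  ultimately obtain b where b: "\<And>u. u \<in> {-r..r} \<Longrightarrow> h b \<le> h u"
    by (meson continuous_attains_inf)
  have "h b \<le> h u" for u
  proof (cases "u \<in> {-r..r}")
    case False
    then have "r \<le> \<bar>u\<bar>" by auto
    then have "\<bar>s\<bar> \<le> \<mu> / 2 * \<bar>u\<bar>"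
      using assms(2) by (simp add: r_def field_simps)
    then have "\<bar>s\<bar> * \<bar>u\<bar> \<le> \<mu> / 2 * \<bar>u\<bar> * \<bar>u\<bar>"
      by (rule mult_right_mono) simp
    moreover have "s * u \<ge> - (\<bar>s\<bar> * \<bar>u\<bar>)"
      by (metis abs_ge_minus_self abs_mult minus_le_iff)
    ultimately have "s * u + \<mu> / 2 * u\<^sup>2 \<ge> 0"
      by (simp add: power2_eq_square mult.assoc)
    then have "h 0 \<le> h u" using s[of u] by simp
    with b[of 0] \<open>r \<ge> 0\<close> show ?thesis by simp
  qed (rule b)
  then show ?thesis using that by blast
qed

text \<open>Applied with \<open>\<kappa> = 1 / \<tau>\<close> to the proximal objective and with
  \<open>\<kappa> = 0\<close> to the function tilted by the optimal slope.\<close>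

lemma strongly_convex_add_quadratic:
  assumes "strongly_convex \<mu> h" "\<mu> \<ge> 0" "\<kappa> \<ge> 0"
  shows "strongly_convex (\<mu> + \<kappa>) (\<lambda>a. c * a + h a + \<kappa> / 2 * (a - x)\<^sup>2)"
proof -
  obtain h' where h': "\<And>a b. h a \<ge> h b + h' b * (a - b) + \<mu> / 2 * (a - b)\<^sup>2"
    using assms(1) unfolding strongly_convex_def by blast
  let ?h' = "\<lambda>b. c + h' b + \<kappa> * (b - x)"
  have *: "c * a + h a + \<kappa> / 2 * (a - x)\<^sup>2
      \<ge> c * b + h b + \<kappa> / 2 * (b - x)\<^sup>2 + ?h' b * (a - b) + (\<mu> + \<kappa>) / 2 * (a - b)\<^sup>2" for a b
    using h'[of b a] by (simp add: field_simps power2_eq_square)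
  moreover have "(\<mu> + \<kappa>) / 2 * (a - b)\<^sup>2 \<ge> 0" for a b
    using assms by simp
  ultimately have "?h' b \<in> subdifferential (\<lambda>a. c * a + h a + \<kappa> / 2 * (a - x)\<^sup>2) b" for b
    unfolding subdifferential_def mem_Collect_eq by (smt (verit, best))
  with * show ?thesis unfolding strongly_convex_def by (intro exI[of _ ?h']) blast
qed

text \<open>Sum of two growth bounds: the proximal objective at its minimizer \<open>v\<close>,
  tested at \<open>w\<close>, and the tilted \<open>h\<close> at its minimizer \<open>w\<close>,
  tested at \<open>v\<close>. The values of \<open>h\<close> cancel, and the two halves of
  \<open>\<mu>\<close> add up to the full modulus.\<close>

lemma arg_min_prox_ineq:
  assumes "strongly_convex \<mu> h" "\<mu> > 0" "\<tau> > 0"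
    and "\<And>u. c' * w + h w \<le> c' * u + h u"
    and "v = arg_min (\<lambda>\<alpha>. c * \<alpha> + h \<alpha> + 1 / (2 * \<tau>) * (\<alpha> - x)\<^sup>2) (\<lambda>_. True)"
  shows "(\<mu> + 1 / (2 * \<tau>)) * (v - w)\<^sup>2 + 1 / (2 * \<tau>) * (v - x)\<^sup>2 - 1 / (2 * \<tau>) * (x - w)\<^sup>2
    \<le> (v - w) * (c' - c)"
proof -
  let ?F = "\<lambda>\<alpha>. c * \<alpha> + h \<alpha> + 1 / (2 * \<tau>) * (\<alpha> - x)\<^sup>2"
  have sc: "strongly_convex (\<mu> + 1 / \<tau>) ?F"
  proof -
    have "1 / \<tau> / 2 = 1 / (2 * \<tau>)" by simp
    then show ?thesis
      using strongly_convex_add_quadratic[of \<mu> h "1 / \<tau>" c x] assms(1-3) by (simp only:) simp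
  qed
  obtain b where b: "\<And>u. ?F b \<le> ?F u"
    using strongly_convex_attains_min[OF sc] assms(2,3) by (metis add_pos_pos zero_less_divide_1_iff)
  have "?F v \<le> ?F u" for u
    unfolding assms(5) by (rule arg_minI[where f = ?F]) (use b in \<open>auto simp: not_less\<close>)
  from strongly_convex_minimizer_growth[OF sc this]
  have "?F w \<ge> ?F v + (\<mu> + 1 / \<tau>) / 2 * (w - v)\<^sup>2" .
  moreover have "c' * v + h v + 0 / 2 * (v - 0)\<^sup>2
      \<ge> c' * w + h w + 0 / 2 * (w - 0)\<^sup>2 + (\<mu> + 0) / 2 * (v - w)\<^sup>2"
    by (rule strongly_convex_minimizer_growth[OF strongly_convex_add_quadratic])
      (use assms in auto)
  moreover have "(\<mu> + 1 / \<tau>) / 2 * (w - v)\<^sup>2 = \<mu> / 2 * (v - w)\<^sup>2 + 1 / (2 * \<tau>) * (v - w)\<^sup>2"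
    by (simp add: power2_commute[of w v] field_simps)
  ultimately show ?thesis
    by (simp add: algebra_simps add_divide_distrib power2_commute[of w x] power2_commute[of w v])
qed

section \<open>Saddle points\<close>

lemma row_inner_eq: "row i A \<bullet> x = (A *v x) $ i"
  by (simp add: row_def matrix_vector_mul_component vec_lambda_eta)

lemma column_inner_eq: "column j A \<bullet> y = (transpose A *v y) $ j"
  by (simp add: matrix_vector_mul_component column_def transpose_def)

lemma inner_transpose_swap:
  fixes A :: "real^'p::finite^'n::finite"
  shows "x \<bullet> (transpose A *v y) = y \<bullet> (A *v x)"
  by (metis dot_lmul_matrix inner_commute transpose_matrix_vector)

lemma inner_transpose_mult:
  fixes A :: "real^'p::finite^'n::finite"
  shows "x \<bullet> (transpose A *v y) = (\<Sum>i\<in>UNIV. y $ i * (row i A \<bullet> x))"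
  unfolding inner_transpose_swap row_inner_eq by (simp add: inner_vec_def)

text \<open>Move \<open>xs\<close> along coordinate \<open>j\<close> by a fraction \<open>e\<close>
  of the way to \<open>\<alpha>\<close>. Smoothness bounds the loss terms by a first-order part plus
  \<open>e\<^sup>2 * B\<close>, convexity bounds \<open>g j\<close> by its chord; dividing by
  \<open>e\<close> and letting it tend to 0 leaves the claim.\<close>

lemma primal_minimizer_coordinatewise:
  fixes A :: "real^'p::finite^'n::finite"
  assumes "lam > 0" "\<And>j. strongly_convex lam (g j)" "\<And>i. smooth_with L (\<phi> i)"
    and min: "\<And>x. primal_obj A \<phi> g xs \<le> primal_obj A \<phi> g x"
    and y: "\<And>i. y $ i = deriv (\<phi> i) (row i A \<bullet> xs)"
    and c: "c = 1 / real CARD('n) * (column j A \<bullet> y)"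
  shows "c * xs $ j + g j (xs $ j) \<le> c * \<alpha> + g j \<alpha>"
proof -
  define N where "N = real CARD('n)"
  have "N > 0" by (simp add: N_def)
  define \<delta> where "\<delta> = \<alpha> - xs $ j"
  define B where "B = 1 / N * (\<Sum>i\<in>UNIV. L / 2 * (\<delta> * A $ i $ j)\<^sup>2)"
  have *: "0 \<le> c * \<delta> + (g j \<alpha> - g j (xs $ j)) + e * B" if e: "0 < e" "e < 1" for e
  proof -
    define x where "x = xs + (e * \<delta>) *\<^sub>R axis j 1"
    have row: "row i A \<bullet> x = row i A \<bullet> xs + e * \<delta> * A $ i $ j" for i
      by (simp add: x_def inner_add_right inner_axis row_def)
    have "\<phi> i (row i A \<bullet> x) \<le> \<phi> i (row i A \<bullet> xs) + e * (\<delta> * A $ i $ j * y $ i)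
        + e\<^sup>2 * (L / 2 * (\<delta> * A $ i $ j)\<^sup>2)" for i
    proof -
      have "\<phi> i (row i A \<bullet> x) \<le> \<phi> i (row i A \<bullet> xs)
          + deriv (\<phi> i) (row i A \<bullet> xs) * (row i A \<bullet> x - row i A \<bullet> xs)
          + L / 2 * (row i A \<bullet> x - row i A \<bullet> xs)\<^sup>2"
        using assms(3)[of i] unfolding smooth_with_def by blast
      then show ?thesis
        by (simp add: row y power_mult_distrib algebra_simps)
    qed
    then have "(\<Sum>i\<in>UNIV. \<phi> i (row i A \<bullet> x)) \<le> (\<Sum>i\<in>UNIV. \<phi> i (row i A \<bullet> xs)
        + e * (\<delta> * A $ i $ j * y $ i) + e\<^sup>2 * (L / 2 * (\<delta> * A $ i $ j)\<^sup>2))"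
      by (rule sum_mono)
    also have "\<dots> = (\<Sum>i\<in>UNIV. \<phi> i (row i A \<bullet> xs)) + e * (N * (c * \<delta>)) + e\<^sup>2 * (N * B)"
    proof -
      have "N * (c * \<delta>) = (\<Sum>i\<in>UNIV. \<delta> * A $ i $ j * y $ i)"
        using \<open>N > 0\<close>
        by (simp add: c N_def[symmetric] column_def inner_vec_def sum_distrib_left sum_distrib_right mult_ac)
      moreover have "N * B = (\<Sum>i\<in>UNIV. L / 2 * (\<delta> * A $ i $ j)\<^sup>2)"
        using \<open>N > 0\<close> by (simp add: B_def)
      ultimately show ?thesis
        by (simp only: sum.distrib sum_distrib_left)
    qed
    finally have "1 / N * (\<Sum>i\<in>UNIV. \<phi> i (row i A \<bullet> x))
        \<le> 1 / N * ((\<Sum>i\<in>UNIV. \<phi> i (row i A \<bullet> xs)) + e * (N * (c * \<delta>)) + e\<^sup>2 * (N * B))"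
      using \<open>N > 0\<close> by (intro mult_left_mono) auto
    then have 1: "1 / N * (\<Sum>i\<in>UNIV. \<phi> i (row i A \<bullet> x))
        \<le> 1 / N * (\<Sum>i\<in>UNIV. \<phi> i (row i A \<bullet> xs)) + e * (c * \<delta>) + e\<^sup>2 * B"
      using \<open>N > 0\<close> by (simp add: field_simps)
    have "separable_sum g x = g j (x $ j) + (\<Sum>k\<in>UNIV - {j}. g k (x $ k))"
      unfolding separable_sum_def by (rule sum.remove) auto
    moreover have "separable_sum g xs = g j (xs $ j) + (\<Sum>k\<in>UNIV - {j}. g k (xs $ k))"
      unfolding separable_sum_def by (rule sum.remove) auto
    moreover have "(\<Sum>k\<in>UNIV - {j}. g k (x $ k)) = (\<Sum>k\<in>UNIV - {j}. g k (xs $ k))"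
      by (intro sum.cong) (auto simp: x_def axis_def)
    ultimately have "separable_sum g x = separable_sum g xs + (g j (x $ j) - g j (xs $ j))"
      by simp
    moreover have "g j (x $ j) \<le> (1 - e) * g j (xs $ j) + e * g j \<alpha>"
    proof -
      have "x $ j = (1 - e) *\<^sub>R (xs $ j) + e *\<^sub>R \<alpha>"
        by (simp add: x_def \<delta>_def axis_def algebra_simps)
      then show ?thesis
        using convex_onD[OF strongly_convex_imp_convex_on[OF assms(2)[of j]], of e "xs $ j" \<alpha>] e assms(1)
        by simp
    qed
    ultimately have "separable_sum g x \<le> separable_sum g xs + e * (g j \<alpha> - g j (xs $ j))"
      by (simp add: algebra_simps)
    with 1 min[of x] have "0 \<le> e * (c * \<delta>) + e\<^sup>2 * B + e * (g j \<alpha> - g j (xs $ j))"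
      unfolding primal_obj_def N_def[symmetric] by linarith
    also have "\<dots> = e * (c * \<delta> + (g j \<alpha> - g j (xs $ j)) + e * B)"
      by (simp add: algebra_simps power2_eq_square)
    finally show ?thesis using e by (simp add: zero_le_mult_iff)
  qed
  have "((\<lambda>e. c * \<delta> + (g j \<alpha> - g j (xs $ j)) + e * B)
      \<longlongrightarrow> c * \<delta> + (g j \<alpha> - g j (xs $ j)) + 0 * B) (at_right 0)"
    by (intro tendsto_intros)
  moreover have "\<forall>\<^sub>F e in at_right 0. 0 \<le> c * \<delta> + (g j \<alpha> - g j (xs $ j)) + e * B"
    by (rule eventually_mono[OF eventually_at_right_real[of 0 1]]) (use * in auto)
  ultimately have "0 \<le> c * \<delta> + (g j \<alpha> - g j (xs $ j)) + 0 * B"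
    by (intro tendsto_lowerbound) auto
  then show ?thesis by (simp add: \<delta>_def algebra_simps)
qed

text \<open>Weak duality with test points \<open>z i\<close> that are independent of
  \<open>x\<close>. This freedom allows a dual maximizer to be tested one coordinate at a
  time.\<close>

lemma dual_obj_le:
  fixes A :: "real^'p::finite^'n::finite"
  shows "dual_obj A \<phi> g y \<le> ereal (separable_sum g x
    + 1 / real CARD('n) * (\<Sum>i\<in>UNIV. \<phi> i (z i) + y $ i * (row i A \<bullet> x - z i)))"
proof -
  define N where "N = real CARD('n)"
  define v where "v = - (1 / N) *\<^sub>R (transpose A *v y)"
  have "ereal (1 / N) * (\<Sum>i\<in>UNIV. ereal (z i * y $ i - \<phi> i (z i)))
      \<le> ereal (1 / N) * (\<Sum>i\<in>UNIV. convex_conjugate (\<phi> i) (y $ i))"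
    using convex_conjugate_ge[of "z i" "y $ i" "\<phi> i" for i]
    by (intro ereal_mult_left_mono sum_mono) (auto simp: N_def)
  moreover have "- convex_conjugate (separable_sum g) v \<le> - ereal (x \<bullet> v - separable_sum g x)"
    using convex_conjugate_ge by (simp only: ereal_minus_le_minus)
  ultimately have "dual_obj A \<phi> g y \<le> - ereal (x \<bullet> v - separable_sum g x)
      - ereal (1 / N) * (\<Sum>i\<in>UNIV. ereal (z i * y $ i - \<phi> i (z i)))"
    unfolding dual_obj_def N_def[symmetric] v_def[symmetric] by (intro ereal_minus_mono)
  also have "\<dots> = ereal (separable_sum g x - x \<bullet> v - 1 / N * (\<Sum>i\<in>UNIV. z i * y $ i - \<phi> i (z i)))"
    by simp
  also have "separable_sum g x - x \<bullet> v - 1 / N * (\<Sum>i\<in>UNIV. z i * y $ i - \<phi> i (z i))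
      = separable_sum g x + 1 / N * (\<Sum>i\<in>UNIV. \<phi> i (z i) + y $ i * (row i A \<bullet> x - z i))"
  proof -
    have "x \<bullet> v = - (1 / N) * (\<Sum>i\<in>UNIV. y $ i * (row i A \<bullet> x))"
      unfolding v_def inner_scaleR_right inner_transpose_mult ..
    then show ?thesis
      by (simp add: sum_subtractf sum.distrib right_diff_distrib add_divide_distrib diff_divide_distrib mult.commute)
  qed
  finally show ?thesis unfolding N_def .
qed

text \<open>The first-order conditions make \<open>x\<close> and the numbers
  \<open>row i A \<bullet> x\<close> attain the suprema in the conjugates, which closes the duality
  gap.\<close>

lemma dual_obj_attained:
  fixes A :: "real^'p::finite^'n::finite"
  assumes "\<And>i. convex_on UNIV (\<phi> i)" "\<And>i. smooth_with L (\<phi> i)"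
    and y: "\<And>i. y $ i = deriv (\<phi> i) (row i A \<bullet> x)"
    and g: "\<And>j \<alpha>. 1 / real CARD('n) * (column j A \<bullet> y) * x $ j + g j (x $ j)
      \<le> 1 / real CARD('n) * (column j A \<bullet> y) * \<alpha> + g j \<alpha>"
  shows "dual_obj A \<phi> g y = ereal (primal_obj A \<phi> g x)"
proof -
  define N where "N = real CARD('n)"
  define v where "v = - (1 / N) *\<^sub>R (transpose A *v y)"
  have v: "v $ j = - (1 / N * (column j A \<bullet> y))" for j
    by (simp add: v_def column_inner_eq)
  have "u \<bullet> v - separable_sum g u \<le> x \<bullet> v - separable_sum g x" for u
  proof -
    have "(\<Sum>j\<in>UNIV. u $ j * v $ j - g j (u $ j)) \<le> (\<Sum>j\<in>UNIV. x $ j * v $ j - g j (x $ j))"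
    proof (rule sum_mono)
      fix j show "u $ j * v $ j - g j (u $ j) \<le> x $ j * v $ j - g j (x $ j)"
        using g[of j "u $ j"] by (simp add: v N_def mult.commute)
    qed
    then show ?thesis by (simp add: inner_vec_def separable_sum_def sum_subtractf)
  qed
  then have 1: "convex_conjugate (separable_sum g) v = ereal (x \<bullet> v - separable_sum g x)"
    by (rule convex_conjugate_attained)
  have 2: "convex_conjugate (\<phi> i) (y $ i)
      = ereal ((row i A \<bullet> x) * y $ i - \<phi> i (row i A \<bullet> x))" for i
    by (subst convex_conjugate_attained[of _ _ "row i A \<bullet> x"])
      (use smooth_with_above_tangent[OF assms(1)[of i] assms(2)[of i]] y[of i] in \<open>auto simp: algebra_simps\<close>)
  have "x \<bullet> v = - (1 / N) * (\<Sum>i\<in>UNIV. (row i A \<bullet> x) * y $ i)"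
    unfolding v_def inner_scaleR_right inner_transpose_mult by (simp add: mult.commute)
  then show ?thesis
    unfolding dual_obj_def N_def[symmetric] v_def[symmetric] primal_obj_def 1 2
    by (simp add: sum_subtractf right_diff_distrib diff_divide_distrib)
qed

text \<open>The dual objective at the gradient vector equals the primal optimum; hence every dual maximizer
  attains equality in Fenchel's inequality for each \<open>\<phi> i\<close>, which makes it a subgradient there.\<close>

lemma saddle_point_dual:
  fixes A :: "real^'p::finite^'n::finite"
  assumes "lam > 0" "\<And>j. strongly_convex lam (g j)"
    and cv: "\<And>i. convex_on UNIV (\<phi> i)" and sm: "\<And>i. smooth_with L (\<phi> i)"
    and "is_arg_min (primal_obj A \<phi> g) (\<lambda>_. True) xs"
    and "is_arg_max (dual_obj A \<phi> g) (\<lambda>_. True) ys"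
  shows "ys $ i = deriv (\<phi> i) (row i A \<bullet> xs)"
proof (rule smooth_with_subgradient_unique[OF sm])
  fix z
  define N where "N = real CARD('n)"
  have "N > 0" by (simp add: N_def)
  have min: "primal_obj A \<phi> g xs \<le> primal_obj A \<phi> g x" for x
    using assms(5) by (simp add: is_arg_min_linorder)
  define y :: "real^'n" where "y = (\<chi> i. deriv (\<phi> i) (row i A \<bullet> xs))"
  have y: "y $ i = deriv (\<phi> i) (row i A \<bullet> xs)" for i
    by (simp add: y_def)
  \<comment> \<open>Only the test point of coordinate \<open>i\<close> moves; for every other
    coordinate the term equals its primal counterpart and cancels.\<close>
  define zs where "zs = (\<lambda>k. if k = i then z else row k A \<bullet> xs)"
  have "ereal (primal_obj A \<phi> g xs) = dual_obj A \<phi> g y"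
    by (rule dual_obj_attained[OF cv sm y, symmetric])
      (rule primal_minimizer_coordinatewise[OF assms(1,2) sm min y refl])
  also have "\<dots> \<le> dual_obj A \<phi> g ys"
    using assms(6) by (simp add: is_arg_max_linorder)
  also have "\<dots> \<le> ereal (separable_sum g xs
      + 1 / N * (\<Sum>k\<in>UNIV. \<phi> k (zs k) + ys $ k * (row k A \<bullet> xs - zs k)))"
    unfolding N_def by (rule dual_obj_le)
  finally have "primal_obj A \<phi> g xs \<le> separable_sum g xs
      + 1 / N * (\<Sum>k\<in>UNIV. \<phi> k (zs k) + ys $ k * (row k A \<bullet> xs - zs k))"
    by (simp only: ereal_less_eq)
  then have "(\<Sum>k\<in>UNIV. \<phi> k (row k A \<bullet> xs))
      \<le> (\<Sum>k\<in>UNIV. \<phi> k (zs k) + ys $ k * (row k A \<bullet> xs - zs k))"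
    using \<open>N > 0\<close> by (simp add: primal_obj_def N_def[symmetric] divide_le_cancel)
  moreover have "(\<Sum>k\<in>UNIV. \<phi> k (zs k) + ys $ k * (row k A \<bullet> xs - zs k))
      = (\<phi> i z + ys $ i * (row i A \<bullet> xs - z)) + (\<Sum>k\<in>UNIV - {i}. \<phi> k (row k A \<bullet> xs))"
    by (subst sum.remove[of _ i]) (auto simp: zs_def intro!: sum.cong)
  moreover have "(\<Sum>k\<in>UNIV. \<phi> k (row k A \<bullet> xs))
      = \<phi> i (row i A \<bullet> xs) + (\<Sum>k\<in>UNIV - {i}. \<phi> k (row k A \<bullet> xs))"
    by (rule sum.remove) auto
  ultimately show "\<phi> i (row i A \<bullet> xs) + ys $ i * (z - row i A \<bullet> xs) \<le> \<phi> i z"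
    by (simp add: algebra_simps)
qed

section \<open>Uniformly random blocks\<close>

lemma fixed_card_subsets:
  assumes "m \<le> CARD('a::finite)"
  shows "finite {I :: 'a set. card I = m}" "{I :: 'a set. card I = m} \<noteq> {}"
    "card {I :: 'a set. card I = m} = CARD('a) choose m"
proof -
  show "finite {I :: 'a set. card I = m}" by simp
  show "{I :: 'a set. card I = m} \<noteq> {}"
    using obtain_subset_with_card_n[OF assms] by blast
  show "card {I :: 'a set. card I = m} = CARD('a) choose m"
    using n_subsets[of "UNIV :: 'a set" m] by simp
qed

lemma card_fixed_card_subsets_containing:
  fixes i :: "'a::finite"
  assumes "m \<ge> 1"
  shows "card {I. card I = m \<and> i \<in> I} = (CARD('a) - 1) choose (m - 1)"
proof -
  have "{I. card I = m \<and> i \<in> I} = insert i ` {B. B \<subseteq> UNIV - {i} \<and> card B = m - 1}"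
  proof (intro equalityI subsetI)
    fix I assume I: "I \<in> {I. card I = m \<and> i \<in> I}"
    then have "I = insert i (I - {i})" "I - {i} \<in> {B. B \<subseteq> UNIV - {i} \<and> card B = m - 1}"
      by auto
    then show "I \<in> insert i ` {B. B \<subseteq> UNIV - {i} \<and> card B = m - 1}" by (rule image_eqI)
  next
    fix I assume "I \<in> insert i ` {B. B \<subseteq> UNIV - {i} \<and> card B = m - 1}"
    then obtain B where B: "I = insert i B" "i \<notin> B" "card B = m - 1" by auto
    then have "card I = Suc (card B)" by simp
    then show "I \<in> {I. card I = m \<and> i \<in> I}" using B assms by simp
  qed
  moreover have "inj_on (insert i) {B. B \<subseteq> UNIV - {i} \<and> card B = m - 1}"
    by (rule inj_onI) (simp, blast)
  ultimately show ?thesis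
    using n_subsets[of "UNIV - {i}" "m - 1"] by (simp add: card_image)
qed

lemma prob_mem_fixed_card_subset:
  fixes i :: "'a::finite"
  assumes "m \<in> {1..CARD('a)}"
  shows "measure_pmf.expectation (pmf_of_set {I. card I = m}) (\<lambda>I. if i \<in> I then 1 else 0)
    = real m / real CARD('a)"
proof -
  have m: "m \<ge> 1" "m \<le> CARD('a)" using assms by auto
  note S = fixed_card_subsets[OF m(2)]
  have "measure_pmf.expectation (pmf_of_set {I. card I = m}) (\<lambda>I. if i \<in> I then 1 else 0)
      = real (card {I. card I = m \<and> i \<in> I}) / real (CARD('a) choose m)"
    using S by (simp add: integral_pmf_of_set sum.If_cases Int_def)
  also have "\<dots> = real m / real CARD('a)"
  proof -
    have "m * (CARD('a) choose m) = CARD('a) * ((CARD('a) - 1) choose (m - 1))"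
      using times_binomial_minus1_eq[of m "CARD('a)"] m by simp
    then have "real m * real (CARD('a) choose m) = real CARD('a) * real ((CARD('a) - 1) choose (m - 1))"
      by (metis of_nat_mult)
    moreover have "real (CARD('a) choose m) > 0" "real CARD('a) > 0"
      using m by simp_all
    ultimately show ?thesis
      unfolding card_fixed_card_subsets_containing[OF m(1)] by (simp add: field_simps)
  qed
  finally show ?thesis .
qed

lemma integrable_finite_pmf_of_set:
  fixes f :: "'a::finite set \<Rightarrow> real"
  shows "integrable (measure_pmf (p :: 'a set pmf)) f"
  by (rule integrable_measure_pmf_finite) simp

text \<open>By linearity only the marginal inclusion probability of each index enters, so possible
  dependence between memberships is harmless.\<close>

lemma expectation_sampled_sum:
  fixes a b :: "'a::finite \<Rightarrow> real"
  assumes "m \<in> {1..CARD('a)}"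
  shows "measure_pmf.expectation (pmf_of_set {I. card I = m}) (\<lambda>I. \<Sum>i\<in>UNIV. if i \<in> I then a i else b i)
    = (\<Sum>i\<in>UNIV. m / CARD('a) * a i + (1 - m / CARD('a)) * b i)"
proof -
  note int = integrable_finite_pmf_of_set
  have "measure_pmf.expectation (pmf_of_set {I. card I = m}) (\<lambda>I. if i \<in> I then a i else b i)
      = m / CARD('a) * a i + (1 - m / CARD('a)) * b i" for i
  proof -
    have "(\<lambda>I. if i \<in> I then a i else b i) = (\<lambda>I. b i + (a i - b i) * (if i \<in> I then 1 else 0))"
      by auto
    then have "measure_pmf.expectation (pmf_of_set {I. card I = m}) (\<lambda>I. if i \<in> I then a i else b i)
      = b i + (a i - b i) * measure_pmf.expectation (pmf_of_set {I. card I = m}) (\<lambda>I. if i \<in> I then 1 else 0)"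
      by (simp only:) (subst Bochner_Integration.integral_add; simp add: int)
    then show ?thesis
      unfolding prob_mem_fixed_card_subset[OF assms] by (simp add: algebra_simps diff_divide_distrib)
  qed
  then show ?thesis
    by (subst Bochner_Integration.integral_sum) (auto intro: int)
qed

text \<open>Both half-steps of the method are instances: a proximal inequality for the full update \<open>u'\<close>
  becomes, in expectation, a descent inequality for the update restricted to a random block.\<close>

lemma expected_block_step:
  fixes u u' w k :: "real^'a::finite"
  assumes m: "m \<in> {1..CARD('a)}" and r: "r = real CARD('a) / real m"
    and prox: "\<And>i. (\<mu> + s) * (u' $ i - w $ i)\<^sup>2 + s * (u' $ i - u $ i)\<^sup>2 - s * (u $ i - w $ i)\<^sup>2
      \<le> (u' $ i - w $ i) * k $ i"
    and v: "\<And>I. v I = (\<chi> i. if i \<in> I then u' $ i else u $ i)"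
  shows "measure_pmf.expectation (pmf_of_set {I. card I = m})
      (\<lambda>I. r * (\<mu> + s) * (norm (w - v I))\<^sup>2 + r * s * (norm (v I - u))\<^sup>2
        - (u + r *\<^sub>R (v I - u) - w) \<bullet> k)
    \<le> (r * (\<mu> + s) - \<mu>) * (norm (w - u))\<^sup>2"
proof -
  define a where "a i = r * (\<mu> + s) * (w $ i - u' $ i)\<^sup>2 + r * s * (u' $ i - u $ i)\<^sup>2
      - (u $ i + r * (u' $ i - u $ i) - w $ i) * k $ i" for i
  define b where "b i = r * (\<mu> + s) * (w $ i - u $ i)\<^sup>2 - (u $ i - w $ i) * k $ i" for i
  have r0: "r > 0" "m / CARD('a) = 1 / r"
    using m by (auto simp: r)
  have norm2: "(norm x)\<^sup>2 = (\<Sum>i\<in>UNIV. (x $ i)\<^sup>2)" for x :: "real^'a"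
    unfolding power2_norm_eq_inner by (simp add: inner_vec_def power2_eq_square)
  have "r * (\<mu> + s) * (norm (w - v I))\<^sup>2 + r * s * (norm (v I - u))\<^sup>2
        - (u + r *\<^sub>R (v I - u) - w) \<bullet> k = (\<Sum>i\<in>UNIV. if i \<in> I then a i else b i)" for I
    unfolding norm2 unfolding inner_vec_def sum_distrib_left sum.distrib[symmetric] sum_subtractf[symmetric]
    by (intro sum.cong refl) (auto simp: a_def b_def v)
  then have "measure_pmf.expectation (pmf_of_set {I. card I = m})
      (\<lambda>I. r * (\<mu> + s) * (norm (w - v I))\<^sup>2 + r * s * (norm (v I - u))\<^sup>2
        - (u + r *\<^sub>R (v I - u) - w) \<bullet> k)
      = (\<Sum>i\<in>UNIV. 1 / r * a i + (1 - 1 / r) * b i)"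
    by (simp only: expectation_sampled_sum[OF m] r0(2))
  also have "\<dots> \<le> (\<Sum>i\<in>UNIV. (r * (\<mu> + s) - \<mu>) * (w $ i - u $ i)\<^sup>2)"
  proof (rule sum_mono)
    fix i
    \<comment> \<open>The extrapolation factor \<open>r\<close> undoes the update probability
      \<open>1 / r\<close>, so the linear term averages to the one of the full step and
      \<open>prox\<close> applies.\<close>
    have "1 / r * a i + (1 - 1 / r) * b i = (\<mu> + s) * (w $ i - u' $ i)\<^sup>2 + s * (u' $ i - u $ i)\<^sup>2
        - (u' $ i - w $ i) * k $ i + (r - 1) * (\<mu> + s) * (w $ i - u $ i)\<^sup>2"
      unfolding a_def b_def using r0(1) by (simp add: field_simps)
    then show "1 / r * a i + (1 - 1 / r) * b i \<le> (r * (\<mu> + s) - \<mu>) * (w $ i - u $ i)\<^sup>2"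
      using prox[of i] by (simp add: algebra_simps power2_commute[of "w $ i"])
  qed
  also have "\<dots> = (r * (\<mu> + s) - \<mu>) * (norm (w - u))\<^sup>2"
    by (simp add: norm2 sum_distrib_left)
  finally show ?thesis .
qed

section \<open>Norm bounds for vectors supported on sampled blocks\<close>

lemma submat_mult_norm_le:
  fixes A :: "real^'p::finite^'n::finite"
  assumes "card I = m" "card J = q" "max_block_norm_sq A q m \<le> \<Lambda>"
  shows "(norm (submat A I J *v u))\<^sup>2 \<le> \<Lambda> * (norm u)\<^sup>2"
proof -
  let ?S = "{(spectral_norm (submat A I J))\<^sup>2 | I J. card I = m \<and> card J = q}"
  have "?S \<subseteq> (\<lambda>(I, J). (spectral_norm (submat A I J))\<^sup>2) ` UNIV" by auto
  then have "finite ?S" by (rule finite_subset) simp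
  then have "(spectral_norm (submat A I J))\<^sup>2 \<le> max_block_norm_sq A q m"
    unfolding max_block_norm_sq_def using assms(1,2) by (intro Max_ge) auto
  then have L: "(spectral_norm (submat A I J))\<^sup>2 \<le> \<Lambda>" using assms(3) by simp
  have "norm (submat A I J *v u) \<le> spectral_norm (submat A I J) * norm u"
    unfolding spectral_norm_def by (rule onorm) (rule matrix_vector_mul_bounded_linear)
  then have "(norm (submat A I J *v u))\<^sup>2 \<le> (spectral_norm (submat A I J) * norm u)\<^sup>2"
    by (rule power_mono) simp
  also have "\<dots> \<le> \<Lambda> * (norm u)\<^sup>2"
    unfolding power_mult_distrib by (rule mult_right_mono[OF L]) simp
  finally show ?thesis .
qed

lemma submat_mult_nth:
  assumes "\<And>j. j \<notin> J \<Longrightarrow> u $ j = 0"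
  shows "(submat A I J *v u) $ i = (if i \<in> I then (A *v u) $ i else 0)"
  unfolding matrix_vector_mult_def submat_def using assms
  by (auto intro!: sum.cong sum.neutral)

lemma inner_mult_block_le:
  fixes A :: "real^'p::finite^'n::finite"
  assumes "card I = m" "card J = q" "max_block_norm_sq A q m \<le> \<Lambda>"
    and "\<And>i. i \<notin> I \<Longrightarrow> v $ i = 0" "\<And>j. j \<notin> J \<Longrightarrow> u $ j = 0"
  shows "\<bar>v \<bullet> (A *v u)\<bar> \<le> sqrt \<Lambda> * norm v * norm u"
proof -
  have "v \<bullet> (A *v u) = v \<bullet> (submat A I J *v u)"
    using assms(4) by (auto simp: inner_vec_def submat_mult_nth[OF assms(5)] intro!: sum.cong)
  also have "\<bar>\<dots>\<bar> \<le> norm v * norm (submat A I J *v u)"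
    by (rule Cauchy_Schwarz_ineq2)
  also have "\<dots> \<le> norm v * sqrt (\<Lambda> * (norm u)\<^sup>2)"
    by (intro mult_left_mono real_le_rsqrt submat_mult_norm_le[OF assms(1-3)]) simp
  finally show ?thesis by (simp add: real_sqrt_mult mult_ac)
qed

text \<open>Averaging the block bound over a uniformly random row set of size \<open>m\<close> covers all rows.\<close>

lemma norm_mult_column_block_le:
  fixes A :: "real^'p::finite^'n::finite"
  assumes m: "m \<in> {1..CARD('n)}" and "card J = q" "max_block_norm_sq A q m \<le> \<Lambda>"
    and u: "\<And>j. j \<notin> J \<Longrightarrow> u $ j = 0"
  shows "(norm (A *v u))\<^sup>2 \<le> real CARD('n) / real m * \<Lambda> * (norm u)\<^sup>2"
proof -
  have norm2: "(norm x)\<^sup>2 = (\<Sum>i\<in>UNIV. (x $ i)\<^sup>2)" for x :: "real^'n"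
    unfolding power2_norm_eq_inner by (simp add: inner_vec_def power2_eq_square)
  let ?P = "pmf_of_set {I :: 'n set. card I = m}"
  have "(norm (submat A I J *v u))\<^sup>2 = (\<Sum>i\<in>UNIV. if i \<in> I then ((A *v u) $ i)\<^sup>2 else 0)" for I
    unfolding norm2 by (intro sum.cong) (auto simp: submat_mult_nth[OF u])
  then have "measure_pmf.expectation ?P (\<lambda>I. (norm (submat A I J *v u))\<^sup>2)
      = real m / real CARD('n) * (norm (A *v u))\<^sup>2"
    by (simp only: expectation_sampled_sum[OF m] norm2 sum_distrib_left) simp
  moreover have "measure_pmf.expectation ?P (\<lambda>I. (norm (submat A I J *v u))\<^sup>2)
      \<le> measure_pmf.expectation ?P (\<lambda>I. \<Lambda> * (norm u)\<^sup>2)"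
  proof (rule integral_mono_AE)
    have "set_pmf ?P = {I. card I = m}"
      using fixed_card_subsets(1,2)[where 'a = 'n and m = m] m by (intro set_pmf_of_set) auto
    then show "AE I in ?P. (norm (submat A I J *v u))\<^sup>2 \<le> \<Lambda> * (norm u)\<^sup>2"
      by (auto simp: AE_measure_pmf_iff intro: submat_mult_norm_le[OF _ assms(2,3)])
  qed (auto intro: integrable_finite_pmf_of_set)
  ultimately have "real m / real CARD('n) * (norm (A *v u))\<^sup>2 \<le> \<Lambda> * (norm u)\<^sup>2"
    by simp
  then show ?thesis using m by (simp add: field_simps)
qed

section \<open>Elementary inequalities and expectations over finite supports\<close>

lemma young_ineq:
  fixes c P Q x y :: real
  assumes "c\<^sup>2 \<le> 4 * P * Q" "P \<ge> 0" "Q \<ge> 0"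
  shows "\<bar>c * x * y\<bar> \<le> P * x\<^sup>2 + Q * y\<^sup>2"
proof -
  have "\<bar>c\<bar> = sqrt (c\<^sup>2)" by simp
  also have "\<dots> \<le> sqrt (4 * P * Q)"
    by (rule real_sqrt_le_mono) fact
  also have "\<dots> = 2 * sqrt P * sqrt Q"
    by (simp add: real_sqrt_mult)
  finally have "\<bar>c\<bar> * (\<bar>x\<bar> * \<bar>y\<bar>) \<le> 2 * sqrt P * sqrt Q * (\<bar>x\<bar> * \<bar>y\<bar>)"
    by (rule mult_right_mono) simp
  also have "\<dots> \<le> (sqrt P * \<bar>x\<bar>)\<^sup>2 + (sqrt Q * \<bar>y\<bar>)\<^sup>2"
    using sum_squares_bound[of "sqrt P * \<bar>x\<bar>" "sqrt Q * \<bar>y\<bar>"] by (simp add: mult_ac)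
  also have "\<dots> = P * x\<^sup>2 + Q * y\<^sup>2"
    using assms by (simp add: power_mult_distrib)
  finally show ?thesis by (simp add: abs_mult mult.assoc)
qed

text \<open>Since the sums agree, the smaller of \<open>r\<close> and \<open>s\<close> goes with the
  larger of \<open>a\<close> and \<open>b\<close>; as the smaller of two positive numbers with
  product \<open>S\<^sup>2\<close>, it is at most \<open>S\<close>.\<close>

lemma balanced_sum_le:
  fixes r s a b S :: real
  assumes "r > 0" "s > 0" "S \<ge> 0" "r * s = S\<^sup>2" "r + a = s + b"
  shows "r + a \<le> max a b + S"
proof (cases "a \<le> b")
  case True
  then have "s \<le> r" using assms(5) by linarith
  then have "s * s \<le> r * s" using \<open>s > 0\<close> by (simp add: mult_right_mono)
  then have "s\<^sup>2 \<le> S\<^sup>2" using assms(4) by (simp only: power2_eq_square)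
  then have "s \<le> S" using assms(3) by (rule power2_le_imp_le)
  then show ?thesis using True assms(5) by simp
next
  case False
  then have "r \<le> s" using assms(5) by linarith
  then have "r * r \<le> r * s" using \<open>r > 0\<close> by simp
  then have "r\<^sup>2 \<le> S\<^sup>2" using assms(4) by (simp only: power2_eq_square)
  then have "r \<le> S" using assms(3) by (rule power2_le_imp_le)
  then show ?thesis using False by simp
qed

lemma expectation_mono_finite:
  fixes f h :: "'a \<Rightarrow> real"
  assumes "finite (set_pmf p)" "\<And>s. s \<in> set_pmf p \<Longrightarrow> f s \<le> h s"
  shows "measure_pmf.expectation p f \<le> measure_pmf.expectation p h"
  by (rule integral_mono_AE) (use assms in \<open>auto simp: AE_measure_pmf_iff integrable_measure_pmf_finite\<close>)

lemma expectation_bind_finite: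
  fixes h :: "'b \<Rightarrow> real"
  assumes "finite (set_pmf p)" "\<And>x. x \<in> set_pmf p \<Longrightarrow> finite (set_pmf (f x))"
  shows "measure_pmf.expectation (p \<bind> f) h
    = measure_pmf.expectation p (\<lambda>x. measure_pmf.expectation (f x) h)"
  using assms by (simp add: pmf_expectation_bind[of "set_pmf p"] integral_measure_pmf[of "set_pmf p"])

section \<open>Contraction of the Lyapunov function\<close>

lemma finite_set_pmf_dspdc: "finite (set_pmf (dspdc A \<phi> g \<theta> \<tau> \<sigma> m q x0 y0 t))"
  by (induction t) (auto intro: finite_subset[OF _ finite])

lemma expectation_dspdc_Suc:
  fixes F :: "('n::finite, 'p::finite) dspdc_state \<Rightarrow> real"
  shows "measure_pmf.expectation (dspdc A \<phi> g \<theta> \<tau> \<sigma> m q x0 y0 (Suc t)) F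
    = measure_pmf.expectation (dspdc A \<phi> g \<theta> \<tau> \<sigma> m q x0 y0 t) (\<lambda>s.
        measure_pmf.expectation (pmf_of_set {I. card I = m}) (\<lambda>I.
          measure_pmf.expectation (pmf_of_set {J. card J = q}) (\<lambda>J.
            F (dspdc_step A \<phi> g \<theta> \<tau> \<sigma> m I J s))))"
proof -
  have fin: "finite (set_pmf (r :: 'a::finite set pmf))" for r
    by (rule finite)
  show ?thesis
    by (simp add: expectation_bind_finite finite_set_pmf_dspdc fin)
qed

text \<open>The contraction factor \<open>\<rho>\<close> stays abstract and enters through
  \<open>\<theta>\<close>, \<open>rate_x\<close> and \<open>rate_y\<close>; the saddle point enters
  through its coordinatewise optimality conditions, so the objectives themselves no longer
  appear.\<close>

locale dspdc_setting =
  fixes A :: "real^'p::finite^'n::finite"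
    and \<phi> :: "'n \<Rightarrow> real \<Rightarrow> real" and g :: "'p \<Rightarrow> real \<Rightarrow> real"
    and lam \<gamma> \<Lambda> \<theta> \<tau> \<sigma> n p \<rho> :: real and m q :: nat
    and xs :: "real^'p" and ys :: "real^'n"
  assumes n: "n = real CARD('n)" and p: "p = real CARD('p)"
    and lam: "lam > 0" and \<gamma>: "\<gamma> > 0"
    and sc: "\<And>j. strongly_convex lam (g j)"
    and cv: "\<And>i. convex_on UNIV (\<phi> i)"
    and sm: "\<And>i. smooth_with (1 / \<gamma>) (\<phi> i)"
    and ys: "\<And>i. ys $ i = deriv (\<phi> i) (row i A \<bullet> xs)"
    and xs: "\<And>j \<alpha>. 1 / n * (column j A \<bullet> ys) * xs $ j + g j (xs $ j)
      \<le> 1 / n * (column j A \<bullet> ys) * \<alpha> + g j \<alpha>"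
    and m: "m \<in> {1..CARD('n)}" and q: "q \<in> {1..CARD('p)}"
    and \<Lambda>: "\<Lambda> > 0" "max_block_norm_sq A q m \<le> \<Lambda>"
    and \<tau>: "\<tau> > 0" and \<sigma>: "\<sigma> > 0"
    and \<rho>: "0 < \<rho>" "\<rho> \<le> 1"
    and \<theta>: "\<theta> = \<rho> * (p / q)"
    and \<tau>\<sigma>: "\<tau> * \<sigma> = n * m * q / (4 * p * \<Lambda>)"
    and rate_x: "(1 - \<rho>) * (p / (2 * q * \<tau>) + p * lam / q) \<le> lam"
    and rate_y: "(1 - \<rho>) * (n / (2 * m * \<sigma>) + \<gamma> / m) \<le> \<gamma> / n"
begin

lemma pos: "n > 0" "p > 0" "real m > 0" "real q > 0" "\<theta> > 0" "real m \<le> n"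
  using m q n p \<rho> by (auto simp: \<theta>)

lemma \<Lambda>_eq: "\<Lambda> = n * m * q / (4 * p * \<tau> * \<sigma>)"
  using \<tau>\<sigma> \<tau> \<sigma> \<Lambda> pos by (simp add: field_simps)

text \<open>Here \<open>e\<close> is a dual error and \<open>d\<close> the last primal increment.
  The square carries half of the proximal weight \<open>p / (2 * q * \<tau>)\<close> into the next
  iteration, where it pays for the product of \<open>d\<close> with the next dual increment.\<close>

definition coupling :: "real^'n \<Rightarrow> real^'p \<Rightarrow> real" where
  "coupling e d = p / (q * n) * (e \<bullet> (A *v d)) + p / (4 * q * \<tau>) * (norm d)\<^sup>2"

text \<open>The state records the increment \<open>d\<close> only through \<open>xbar = x + \<theta> d\<close>, hence the division by
  \<open>\<theta>\<close>, which is positive by the assumptions.\<close>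

definition lyapunov :: "('n, 'p) dspdc_state \<Rightarrow> real" where
  "lyapunov = (\<lambda>(x, y, xbar). (p / (2 * q * \<tau>) + p * lam / q) * (norm (xs - x))\<^sup>2
     + (n / (2 * m * \<sigma>) + \<gamma> / m) * (norm (ys - y))\<^sup>2
     + coupling (y - ys) ((1 / \<theta>) *\<^sub>R (xbar - x)))"

text \<open>Invariant that lets \<open>\<Lambda>\<close> control the previous increment too. The
  block is quantified because the state does not record it.\<close>

definition q_sparse :: "('n, 'p) dspdc_state \<Rightarrow> bool" where
  "q_sparse = (\<lambda>(x, y, xbar). \<exists>J. card J = q \<and> (\<forall>j. j \<notin> J \<longrightarrow> (xbar - x) $ j = 0))"

text \<open>The weights on the right are half of the proximal ones. The prescribed
  \<open>\<tau> * \<sigma>\<close> gives equality in the discriminant condition of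
  \<open>young_ineq\<close>.\<close>

lemma block_cross_le:
  assumes "card I = m" "card J = q"
    and "\<And>i. i \<notin> I \<Longrightarrow> v $ i = 0" "\<And>j. j \<notin> J \<Longrightarrow> u $ j = 0"
  shows "\<bar>p / (q * m) * (v \<bullet> (A *v u))\<bar> \<le> n / (4 * m * \<sigma>) * (norm v)\<^sup>2 + p / (4 * q * \<tau>) * (norm u)\<^sup>2"
proof -
  have "\<bar>p / (q * m) * (v \<bullet> (A *v u))\<bar> \<le> p / (q * m) * (sqrt \<Lambda> * norm v * norm u)"
    using mult_left_mono[OF inner_mult_block_le[OF assms(1,2) \<Lambda>(2) assms(3,4)], of "p / (q * m)"] pos
    by (simp add: abs_mult)
  also have "\<dots> \<le> \<bar>(p / (q * m) * sqrt \<Lambda>) * norm v * norm u\<bar>"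
    by (rule order_trans[OF _ abs_ge_self]) (simp add: mult_ac)
  also have "\<dots> \<le> n / (4 * m * \<sigma>) * (norm v)\<^sup>2 + p / (4 * q * \<tau>) * (norm u)\<^sup>2"
  proof (rule young_ineq)
    have "(p / (q * m) * sqrt \<Lambda>)\<^sup>2 = (p / (q * m))\<^sup>2 * \<Lambda>"
      unfolding power_mult_distrib using \<Lambda>(1) by simp
    also have "\<dots> = 4 * (n / (4 * m * \<sigma>)) * (p / (4 * q * \<tau>))"
      unfolding \<Lambda>_eq using pos \<tau> \<sigma> by (simp add: field_simps power2_eq_square)
    finally show "(p / (q * m) * sqrt \<Lambda>)\<^sup>2 \<le> 4 * (n / (4 * m * \<sigma>)) * (p / (4 * q * \<tau>))"
      by simp
  qed (use pos \<tau> \<sigma> in auto)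
  finally show ?thesis .
qed

text \<open>The error \<open>e\<close> is not sparse, so the bound over all rows replaces the block
  bound. Its extra factor \<open>n / m\<close> is outweighed by the coefficient
  \<open>p / (q * n)\<close>, which is \<open>m / n\<close> times the one in
  \<open>block_cross_le\<close>.\<close>

lemma coupling_ge:
  assumes "card J = q" "\<And>j. j \<notin> J \<Longrightarrow> d $ j = 0"
  shows "coupling e d \<ge> - (n / (4 * m * \<sigma>)) * (norm e)\<^sup>2"
proof -
  have "norm (A *v d) \<le> sqrt (n / m * \<Lambda> * (norm d)\<^sup>2)"
    using norm_mult_column_block_le[OF m assms(1) \<Lambda>(2) assms(2)]
    by (intro real_le_rsqrt) (simp add: n)
  then have "norm (A *v d) \<le> sqrt (n / m * \<Lambda>) * norm d"
    by (simp only: real_sqrt_mult real_sqrt_abs abs_norm_cancel)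
  then have "norm e * norm (A *v d) \<le> norm e * (sqrt (n / m * \<Lambda>) * norm d)"
    by (rule mult_left_mono) simp
  then have "\<bar>e \<bullet> (A *v d)\<bar> \<le> norm e * (sqrt (n / m * \<Lambda>) * norm d)"
    using Cauchy_Schwarz_ineq2[of e "A *v d"] by linarith
  then have "p / (q * n) * \<bar>e \<bullet> (A *v d)\<bar> \<le> p / (q * n) * (norm e * (sqrt (n / m * \<Lambda>) * norm d))"
    using pos by (intro mult_left_mono) auto
  also have "\<dots> \<le> \<bar>(p / (q * n) * sqrt (n / m * \<Lambda>)) * norm e * norm d\<bar>"
    by (rule order_trans[OF _ abs_ge_self]) (simp add: mult_ac)
  also have "\<dots> \<le> n / (4 * m * \<sigma>) * (norm e)\<^sup>2 + p / (4 * q * \<tau>) * (norm d)\<^sup>2"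
  proof (rule young_ineq)
    have "(p / (q * n) * sqrt (n / m * \<Lambda>))\<^sup>2 = (p / (q * n))\<^sup>2 * (n / m * \<Lambda>)"
      unfolding power_mult_distrib using \<Lambda>(1) pos(1,3) by simp
    also have "\<dots> = 4 * (1 / (4 * \<sigma>)) * (p / (4 * q * \<tau>))"
      unfolding \<Lambda>_eq using pos \<tau> \<sigma> by (simp add: field_simps power2_eq_square)
    also have "\<dots> \<le> 4 * (n / (4 * m * \<sigma>)) * (p / (4 * q * \<tau>))"
      using pos \<tau> \<sigma> by (intro mult_left_mono mult_right_mono) (auto simp: field_simps)
    finally show "(p / (q * n) * sqrt (n / m * \<Lambda>))\<^sup>2 \<le> 4 * (n / (4 * m * \<sigma>)) * (p / (4 * q * \<tau>))" .
  qed (use pos \<tau> \<sigma> in auto)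
  finally have "\<bar>p / (q * n) * (e \<bullet> (A *v d))\<bar>
      \<le> n / (4 * m * \<sigma>) * (norm e)\<^sup>2 + p / (4 * q * \<tau>) * (norm d)\<^sup>2"
    using pos by (simp add: abs_mult)
  moreover have "- a \<le> X + b" if "\<bar>X\<bar> \<le> a + b" for X a b :: real
    using that by linarith
  ultimately show ?thesis unfolding coupling_def mult_minus_left by blast
qed

text \<open>Absorbing the negative part of the coupling costs half of
  \<open>n / (2 * m * \<sigma>)\<close>; hence the smaller dual coefficient on the left of the
  theorem.\<close>

lemma lyapunov_ge:
  assumes "q_sparse (x, y, xbar)"
  shows "lyapunov (x, y, xbar) \<ge> (p / (2 * q * \<tau>) + p * lam / q) * (norm (xs - x))\<^sup>2
    + (n / (4 * m * \<sigma>) + \<gamma> / m) * (norm (ys - y))\<^sup>2"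
proof -
  obtain J where J: "card J = q" "\<And>j. j \<notin> J \<Longrightarrow> (xbar - x) $ j = 0"
    using assms unfolding q_sparse_def by auto
  have "coupling (y - ys) ((1 / \<theta>) *\<^sub>R (xbar - x)) \<ge> - (n / (4 * m * \<sigma>)) * (norm (y - ys))\<^sup>2"
    by (rule coupling_ge[OF J(1)]) (use J(2) in simp)
  moreover have "n / (2 * m * \<sigma>) = n / (4 * m * \<sigma>) + n / (4 * m * \<sigma>)"
    using pos \<sigma> by (simp add: field_simps)
  ultimately show ?thesis
    unfolding lyapunov_def by (simp add: algebra_simps norm_minus_commute[of y ys])
qed

text \<open>With \<open>z = x - xs\<close>, the terms in \<open>z\<close> cancel between the primal
  and dual half-steps. The products of \<open>e\<close> with \<open>dx\<close> and \<open>d\<close>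
  telescope into the couplings, and only products of \<open>dy\<close> with \<open>dx\<close> and
  \<open>d\<close> remain, which the block bound covers.\<close>

lemma coupling_descent:
  assumes I: "card I = m" "\<And>i. i \<notin> I \<Longrightarrow> dy $ i = 0"
    and J: "card J = q" "\<And>j. j \<notin> J \<Longrightarrow> dx $ j = 0"
    and J': "card J' = q" "\<And>j. j \<notin> J' \<Longrightarrow> d $ j = 0"
    and ebar: "ebar = e + (n / m) *\<^sub>R dy"
  shows "coupling (e + dy) dx \<le> \<rho> * coupling e d
    + (p / (2 * q * \<tau>) * (norm dx)\<^sup>2 - (z + (p / q) *\<^sub>R dx) \<bullet> (- (1 / n) *\<^sub>R (transpose A *v ebar)))
    + (n / (2 * m * \<sigma>) * (norm dy)\<^sup>2 - ebar \<bullet> ((1 / n) *\<^sub>R (A *v (z + \<theta> *\<^sub>R d))))"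
proof -
  define \<alpha> \<beta> where "\<alpha> = dy \<bullet> (A *v dx)" and "\<beta> = dy \<bullet> (A *v d)"
  define a b where "a = e \<bullet> (A *v dx)" and "b = e \<bullet> (A *v d)"
  have "- ((z + (p / q) *\<^sub>R dx) \<bullet> (- (1 / n) *\<^sub>R (transpose A *v ebar)))
      - ebar \<bullet> ((1 / n) *\<^sub>R (A *v (z + \<theta> *\<^sub>R d)))
      = 1 / n * (ebar \<bullet> (A *v (z + (p / q) *\<^sub>R dx)) - ebar \<bullet> (A *v (z + \<theta> *\<^sub>R d)))"
    unfolding inner_scaleR_right inner_transpose_swap by (simp add: right_diff_distrib)
  also have "\<dots> = 1 / n * (p / q * (ebar \<bullet> (A *v dx)) - \<theta> * (ebar \<bullet> (A *v d)))"
    by (simp add: matrix_vector_right_distrib matrix_vector_mult_scaleR inner_add_right)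
  also have "\<dots> = p / (q * n) * a - \<rho> * (p / (q * n) * b) + p / (q * m) * \<alpha> - \<rho> * (p / (q * m) * \<beta>)"
    unfolding ebar \<alpha>_def \<beta>_def a_def b_def inner_add_left inner_scaleR_left \<theta>
    using pos(1-4) by (simp add: field_simps)
  finally have cross: "- ((z + (p / q) *\<^sub>R dx) \<bullet> (- (1 / n) *\<^sub>R (transpose A *v ebar)))
      - ebar \<bullet> ((1 / n) *\<^sub>R (A *v (z + \<theta> *\<^sub>R d))) = \<dots>" .
  have \<alpha>: "p / (q * n) * \<alpha> - p / (q * m) * \<alpha>
      \<le> n / (4 * m * \<sigma>) * (norm dy)\<^sup>2 + p / (4 * q * \<tau>) * (norm dx)\<^sup>2"
  proof -
    \<comment> \<open>The new coupling contributes \<open>p / (q * n)\<close> and the extrapolated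
      \<open>ebar\<close> contributes \<open>p / (q * m)\<close>; the difference is the latter
      scaled by a factor in [0,1].\<close>
    have "p / (q * n) * \<alpha> - p / (q * m) * \<alpha> = (1 - m / n) * - (p / (q * m) * \<alpha>)"
      using pos by (simp add: field_simps)
    also have "\<dots> \<le> (1 - m / n) * \<bar>p / (q * m) * \<alpha>\<bar>"
      using pos(1,6) by (intro mult_left_mono abs_ge_minus_self) simp
    also have "\<dots> \<le> 1 * \<bar>p / (q * m) * \<alpha>\<bar>"
      using pos(1) by (intro mult_right_mono) auto
    also have "\<dots> \<le> n / (4 * m * \<sigma>) * (norm dy)\<^sup>2 + p / (4 * q * \<tau>) * (norm dx)\<^sup>2"
      using block_cross_le[OF I(1) J(1) I(2) J(2)] by (simp add: \<alpha>_def)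
    finally show ?thesis .
  qed
  have \<beta>: "\<rho> * (p / (q * m) * \<beta>)
      \<le> n / (4 * m * \<sigma>) * (norm dy)\<^sup>2 + \<rho> * (p / (4 * q * \<tau>) * (norm d)\<^sup>2)"
  proof -
    have "\<rho> * (p / (q * m) * \<beta>)
        \<le> \<rho> * (n / (4 * m * \<sigma>) * (norm dy)\<^sup>2 + p / (4 * q * \<tau>) * (norm d)\<^sup>2)"
      using order_trans[OF abs_ge_self block_cross_le[OF I(1) J'(1) I(2) J'(2)]] \<rho>
      unfolding \<beta>_def by (intro mult_left_mono) auto
    moreover have "\<rho> * (n / (4 * m * \<sigma>) * (norm dy)\<^sup>2) \<le> 1 * (n / (4 * m * \<sigma>) * (norm dy)\<^sup>2)"
      using \<rho> pos \<sigma> by (intro mult_right_mono) auto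
    ultimately show ?thesis by (simp add: distrib_left)
  qed
  have halves: "p / (2 * q * \<tau>) = p / (4 * q * \<tau>) + p / (4 * q * \<tau>)"
    "n / (2 * m * \<sigma>) = n / (4 * m * \<sigma>) + n / (4 * m * \<sigma>)"
    using pos \<sigma> \<tau> by (simp_all add: field_simps)
  have C: "coupling (e + dy) dx = p / (q * n) * a + p / (q * n) * \<alpha> + p / (4 * q * \<tau>) * (norm dx)\<^sup>2"
    by (simp add: coupling_def inner_add_left a_def \<alpha>_def distrib_left)
  have RC: "\<rho> * coupling e d = \<rho> * (p / (q * n) * b) + \<rho> * (p / (4 * q * \<tau>) * (norm d)\<^sup>2)"
    by (simp add: coupling_def b_def distrib_left)
  \<comment> \<open>Balance of the squares: one \<open>P\<close> enters the new coupling, the other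
    \<open>P\<close> and one \<open>Q\<close> pay for \<open>\<alpha>\<close>, and the second
    \<open>Q\<close> together with the stored \<open>D\<close> pays for
    \<open>\<beta>\<close>.\<close>
  have "C \<le> RC + (P + P - U) + (Q + Q - W)"
    if "C = a1 + a2 + P" "RC = b1 + D" "a2 - a3 \<le> Q + P" "b3 \<le> Q + D" "- U - W = a1 - b1 + a3 - b3"
    for C RC P Q U W D a1 a2 a3 b1 b3 :: real
    using that by linarith
  from this[OF C RC \<alpha> \<beta> cross] show ?thesis
    unfolding halves distrib_right .
qed

lemma dual_prox_ineq:
  assumes "y' = arg_max (\<lambda>\<beta>. ereal (1 / n * (row i A \<bullet> xbar) * \<beta>) - convex_conjugate (\<phi> i) \<beta> / ereal n
      - ereal (1 / (2 * \<sigma>) * (\<beta> - y)\<^sup>2)) (\<lambda>_. True)"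
  shows "(\<gamma> / n + 1 / (2 * \<sigma>)) * (y' - ys $ i)\<^sup>2 + 1 / (2 * \<sigma>) * (y' - y)\<^sup>2
      - 1 / (2 * \<sigma>) * (y - ys $ i)\<^sup>2 \<le> (y' - ys $ i) * ((1 / n) *\<^sub>R (A *v (xbar - xs))) $ i"
proof -
  obtain z where "arg_max (\<lambda>\<beta>. ereal (1 / n * (row i A \<bullet> xbar) * \<beta>) - convex_conjugate (\<phi> i) \<beta> / ereal n
      - ereal (1 / (2 * \<sigma>) * (\<beta> - y)\<^sup>2)) (\<lambda>_. True) = deriv (\<phi> i) z"
    and "z = row i A \<bullet> xbar - n / \<sigma> * (deriv (\<phi> i) z - y)"
    by (rule arg_max_conjugate_prox[OF \<gamma> \<sigma> pos(1) cv sm])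
  then have z: "y' = deriv (\<phi> i) z" "z = row i A \<bullet> xbar - n / \<sigma> * (y' - y)"
    using assms by simp_all
  \<comment> \<open>Cocoercivity between \<open>z\<close> and \<open>row i A \<bullet> xs\<close>,
    whose derivatives are \<open>y'\<close> and \<open>ys $ i\<close>, plays the part of strong
    convexity of the conjugate.\<close>
  have "\<gamma> * (y' - ys $ i)\<^sup>2 \<le> (y' - ys $ i) * (z - row i A \<bullet> xs)"
    unfolding z(1) ys by (rule smooth_with_cocoercive[OF \<gamma> cv sm])
  also have "\<dots> = (y' - ys $ i) * ((A *v (xbar - xs)) $ i - n / \<sigma> * (y' - y))"
    by (subst z(2)) (simp add: row_inner_eq matrix_vector_mult_diff_distrib)
  finally have "1 / n * (\<gamma> * (y' - ys $ i)\<^sup>2)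
      \<le> 1 / n * ((y' - ys $ i) * ((A *v (xbar - xs)) $ i - n / \<sigma> * (y' - y)))"
    using pos by (intro mult_left_mono) auto
  also have "\<dots> = (y' - ys $ i) * ((1 / n) *\<^sub>R (A *v (xbar - xs))) $ i - 1 / \<sigma> * (y' - ys $ i) * (y' - y)"
    using pos(1) by (simp add: field_simps)
  \<comment> \<open>Three-point identity, which produces the squared distances of the proximal
    inequality.\<close>
  also have "1 / \<sigma> * (y' - ys $ i) * (y' - y)
      = 1 / (2 * \<sigma>) * (y' - ys $ i)\<^sup>2 + 1 / (2 * \<sigma>) * (y' - y)\<^sup>2 - 1 / (2 * \<sigma>) * (y - ys $ i)\<^sup>2"
    using \<sigma> by (simp add: field_simps power2_eq_square)
  finally show ?thesis by (simp add: distrib_right)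
qed

lemma primal_prox_ineq:
  assumes "x' = arg_min (\<lambda>\<alpha>. 1 / n * (column j A \<bullet> ybar) * \<alpha> + g j \<alpha>
      + 1 / (2 * \<tau>) * (\<alpha> - x)\<^sup>2) (\<lambda>_. True)"
  shows "(lam + 1 / (2 * \<tau>)) * (x' - xs $ j)\<^sup>2 + 1 / (2 * \<tau>) * (x' - x)\<^sup>2
      - 1 / (2 * \<tau>) * (x - xs $ j)\<^sup>2
    \<le> (x' - xs $ j) * (- (1 / n) *\<^sub>R (transpose A *v (ybar - ys))) $ j"
proof -
  have "(- (1 / n) *\<^sub>R (transpose A *v (ybar - ys))) $ j
      = 1 / n * (column j A \<bullet> ys) - 1 / n * (column j A \<bullet> ybar)"
    unfolding column_inner_eq matrix_vector_mult_diff_distrib by (simp add: diff_divide_distrib)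
  then show ?thesis
    using arg_min_prox_ineq[OF sc lam \<tau> xs assms] by simp
qed

text \<open>The primal candidate depends on \<open>I\<close> through the extrapolated dual point, so
  \<open>J\<close> is averaged first with \<open>I\<close> fixed; the resulting primal bound is free
  of \<open>I\<close>, and the dual terms are averaged afterwards.\<close>

lemma expected_lyapunov_step:
  assumes "q_sparse (x, y, xbar)"
  shows "measure_pmf.expectation (pmf_of_set {I. card I = m}) (\<lambda>I.
      measure_pmf.expectation (pmf_of_set {J. card J = q}) (\<lambda>J.
        lyapunov (dspdc_step A \<phi> g \<theta> \<tau> \<sigma> m I J (x, y, xbar)))) \<le> \<rho> * lyapunov (x, y, xbar)"
proof -
  obtain J' where J': "card J' = q" "\<And>j. j \<notin> J' \<Longrightarrow> (xbar - x) $ j = 0"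
    using assms unfolding q_sparse_def by auto
  define d where "d = (1 / \<theta>) *\<^sub>R (xbar - x)"
  have xbar: "xbar - xs = (x - xs) + \<theta> *\<^sub>R d"
    using pos(5) by (simp add: d_def)
  define yt :: "real^'n" where "yt = (\<chi> i. arg_max (\<lambda>\<beta>. ereal (1 / n * (row i A \<bullet> xbar) * \<beta>)
      - convex_conjugate (\<phi> i) \<beta> / ereal n - ereal (1 / (2 * \<sigma>) * (\<beta> - y $ i)\<^sup>2)) (\<lambda>_. True))"
  define yv :: "'n set \<Rightarrow> real^'n" where "yv I = (\<chi> i. if i \<in> I then yt $ i else y $ i)" for I
  define yb where "yb I = y + (n / m) *\<^sub>R (yv I - y)" for I
  define xt :: "'n set \<Rightarrow> real^'p" where "xt I = (\<chi> j. arg_min (\<lambda>\<alpha>. 1 / n * (column j A \<bullet> yb I) * \<alpha> + g j \<alpha>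
      + 1 / (2 * \<tau>) * (\<alpha> - x $ j)\<^sup>2) (\<lambda>_. True))" for I
  define xv :: "'n set \<Rightarrow> 'p set \<Rightarrow> real^'p" where
    "xv I J = (\<chi> j. if j \<in> J then xt I $ j else x $ j)" for I J
  define ky where "ky = (1 / n) *\<^sub>R (A *v (xbar - xs))"
  define kx where "kx I = - (1 / n) *\<^sub>R (transpose A *v (yb I - ys))" for I
  define Cx Cy where "Cx = p / (2 * q * \<tau>) + p * lam / q" and "Cy = n / (2 * m * \<sigma>) + \<gamma> / m"
  define X where "X I J = Cx * (norm (xs - xv I J))\<^sup>2 + p / (2 * q * \<tau>) * (norm (xv I J - x))\<^sup>2
    - (x + (p / q) *\<^sub>R (xv I J - x) - xs) \<bullet> kx I" for I J
  define Y where "Y I = Cy * (norm (ys - yv I))\<^sup>2 + n / (2 * m * \<sigma>) * (norm (yv I - y))\<^sup>2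
    - (y + (n / m) *\<^sub>R (yv I - y) - ys) \<bullet> ky" for I
  define PI where "PI = pmf_of_set {I :: 'n set. card I = m}"
  define PJ where "PJ = pmf_of_set {J :: 'p set. card J = q}"
  note int = integrable_finite_pmf_of_set

  \<comment> \<open>These match the coefficients of \<open>expected_block_step\<close>: the sampling
    ratios are \<open>p / q\<close> and \<open>n / m\<close>, the moduli \<open>lam\<close> and
    \<open>\<gamma> / n\<close>.\<close>
  have coeff: "p / q * (lam + 1 / (2 * \<tau>)) = Cx" "p / q * (1 / (2 * \<tau>)) = p / (2 * q * \<tau>)"
    "n / m * (\<gamma> / n + 1 / (2 * \<sigma>)) = Cy" "n / m * (1 / (2 * \<sigma>)) = n / (2 * m * \<sigma>)"
    using pos \<sigma> \<tau> by (simp_all add: Cx_def Cy_def field_simps)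
  have EX: "measure_pmf.expectation PJ (X I) \<le> (Cx - lam) * (norm (xs - x))\<^sup>2" for I
    unfolding PJ_def X_def[abs_def] coeff(1,2)[symmetric]
  proof (rule expected_block_step[OF q _ _ xv_def])
    fix j show "(lam + 1 / (2 * \<tau>)) * (xt I $ j - xs $ j)\<^sup>2 + 1 / (2 * \<tau>) * (xt I $ j - x $ j)\<^sup>2
        - 1 / (2 * \<tau>) * (x $ j - xs $ j)\<^sup>2 \<le> (xt I $ j - xs $ j) * kx I $ j"
      unfolding kx_def by (rule primal_prox_ineq) (simp add: xt_def)
  qed (simp add: p)
  have EY: "measure_pmf.expectation PI Y \<le> (Cy - \<gamma> / n) * (norm (ys - y))\<^sup>2"
    unfolding PI_def Y_def[abs_def] coeff(3,4)[symmetric]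
  proof (rule expected_block_step[OF m _ _ yv_def])
    fix i show "(\<gamma> / n + 1 / (2 * \<sigma>)) * (yt $ i - ys $ i)\<^sup>2 + 1 / (2 * \<sigma>) * (yt $ i - y $ i)\<^sup>2
        - 1 / (2 * \<sigma>) * (y $ i - ys $ i)\<^sup>2 \<le> (yt $ i - ys $ i) * ky $ i"
      unfolding ky_def by (rule dual_prox_ineq) (simp add: yt_def)
  qed (simp add: n)

  have step: "dspdc_step A \<phi> g \<theta> \<tau> \<sigma> m I J (x, y, xbar)
      = (xv I J, yv I, x + (\<theta> + 1) *\<^sub>R (xv I J - x))" for I J
    by (simp add: dspdc_step_def Let_def xv_def yv_def xt_def yt_def yb_def n cong: if_cong)
  have V: "lyapunov (dspdc_step A \<phi> g \<theta> \<tau> \<sigma> m I J (x, y, xbar))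
      = Cx * (norm (xs - xv I J))\<^sup>2 + Cy * (norm (ys - yv I))\<^sup>2 + coupling (yv I - ys) (xv I J - x)" for I J
  proof -
    have "x + (\<theta> + 1) *\<^sub>R (xv I J - x) - xv I J = \<theta> *\<^sub>R (xv I J - x)"
      by (simp add: algebra_simps)
    then show ?thesis
      using pos(5) by (simp add: step lyapunov_def Cx_def Cy_def)
  qed
  have le: "lyapunov (dspdc_step A \<phi> g \<theta> \<tau> \<sigma> m I J (x, y, xbar))
      \<le> X I J + (Y I + \<rho> * coupling (y - ys) d)" if "card I = m" "card J = q" for I J
  proof -
    have "coupling ((y - ys) + (yv I - y)) (xv I J - x) \<le> \<rho> * coupling (y - ys) d
      + (p / (2 * q * \<tau>) * (norm (xv I J - x))\<^sup>2
         - ((x - xs) + (p / q) *\<^sub>R (xv I J - x)) \<bullet> (- (1 / n) *\<^sub>R (transpose A *v (yb I - ys))))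
      + (n / (2 * m * \<sigma>) * (norm (yv I - y))\<^sup>2
         - (yb I - ys) \<bullet> ((1 / n) *\<^sub>R (A *v ((x - xs) + \<theta> *\<^sub>R d))))"
      by (rule coupling_descent[OF that(1) _ that(2) _ J'(1)])
        (auto simp: yv_def xv_def d_def yb_def J'(2)[simplified])
    moreover have "(x - xs) + (p / q) *\<^sub>R (xv I J - x) = x + (p / q) *\<^sub>R (xv I J - x) - xs"
      "(y - ys) + (yv I - y) = yv I - ys"
      by simp_all
    ultimately show ?thesis
      unfolding V X_def Y_def kx_def ky_def xbar yb_def[symmetric] by simp
  qed

  have sets: "set_pmf PI = {I. card I = m}" "set_pmf PJ = {J. card J = q}"
    unfolding PI_def PJ_def using m q fixed_card_subsets(1,2)[where 'a = 'n and m = m]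
      fixed_card_subsets(1,2)[where 'a = 'p and m = q] by (auto intro!: set_pmf_of_set)
  have inner: "measure_pmf.expectation PJ (\<lambda>J. lyapunov (dspdc_step A \<phi> g \<theta> \<tau> \<sigma> m I J (x, y, xbar)))
      \<le> (Cx - lam) * (norm (xs - x))\<^sup>2 + (Y I + \<rho> * coupling (y - ys) d)" if "card I = m" for I
  proof -
    have "measure_pmf.expectation PJ (\<lambda>J. lyapunov (dspdc_step A \<phi> g \<theta> \<tau> \<sigma> m I J (x, y, xbar)))
        \<le> measure_pmf.expectation PJ (\<lambda>J. X I J + (Y I + \<rho> * coupling (y - ys) d))"
      by (rule expectation_mono_finite) (use le that sets in auto)
    also have "\<dots> = measure_pmf.expectation PJ (X I) + (Y I + \<rho> * coupling (y - ys) d)"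
      by (subst Bochner_Integration.integral_add) (auto intro: int)
    finally show ?thesis using EX[of I] by linarith
  qed
  have "measure_pmf.expectation PI (\<lambda>I. measure_pmf.expectation PJ (\<lambda>J.
        lyapunov (dspdc_step A \<phi> g \<theta> \<tau> \<sigma> m I J (x, y, xbar))))
      \<le> measure_pmf.expectation PI (\<lambda>I. Y I + ((Cx - lam) * (norm (xs - x))\<^sup>2 + \<rho> * coupling (y - ys) d))"
    by (rule expectation_mono_finite) (use inner sets in \<open>auto simp: add_ac\<close>)
  also have "\<dots> = measure_pmf.expectation PI Y + ((Cx - lam) * (norm (xs - x))\<^sup>2 + \<rho> * coupling (y - ys) d)"
    by (subst Bochner_Integration.integral_add) (auto intro: int)
  also have "\<dots> \<le> (Cy - \<gamma> / n) * (norm (ys - y))\<^sup>2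
      + ((Cx - lam) * (norm (xs - x))\<^sup>2 + \<rho> * coupling (y - ys) d)"
    using EY by simp
  also have "\<dots> \<le> (\<rho> * Cy) * (norm (ys - y))\<^sup>2
      + ((\<rho> * Cx) * (norm (xs - x))\<^sup>2 + \<rho> * coupling (y - ys) d)"
  proof -
    \<comment> \<open>The rate conditions rearranged: lowering the coefficients by the moduli
      shrinks them at least by the factor \<open>\<rho>\<close>.\<close>
    have "Cy - \<gamma> / n \<le> \<rho> * Cy" "Cx - lam \<le> \<rho> * Cx"
      using rate_x rate_y unfolding Cx_def[symmetric] Cy_def[symmetric] by (simp_all add: algebra_simps)
    then show ?thesis by (intro add_mono order_refl) (auto intro: mult_right_mono)
  qed
  also have "\<dots> = \<rho> * lyapunov (x, y, xbar)"
    unfolding lyapunov_def d_def Cx_def Cy_def by (simp add: algebra_simps)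
  finally show ?thesis unfolding PI_def PJ_def .
qed

section \<open>Iterating the one-step bound\<close>

lemma q_sparse_step:
  assumes "card J = q"
  shows "q_sparse (dspdc_step A \<phi> g \<theta> \<tau> \<sigma> m I J s)"
  unfolding q_sparse_def dspdc_step_def Let_def case_prod_beta
  by (intro exI[of _ J]) (auto simp: assms case_prod_beta)

lemma q_sparse_dspdc:
  assumes "s \<in> set_pmf (dspdc A \<phi> g \<theta> \<tau> \<sigma> m q x0 y0 t)"
  shows "q_sparse s"
proof (cases t)
  case 0
  \<comment> \<open>Initially \<open>xbar = x\<close>, so the increment is zero and any block of
    size \<open>q\<close> serves.\<close>
  obtain J :: "'p set" where "card J = q"
    using fixed_card_subsets(2)[where 'a = 'p and m = q] q by auto
  then show ?thesis using assms 0 by (auto simp: q_sparse_def)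
next
  case (Suc t')
  have "set_pmf (pmf_of_set {J :: 'p set. card J = q}) = {J. card J = q}"
    using q fixed_card_subsets(1,2)[where 'a = 'p and m = q] by (intro set_pmf_of_set) auto
  then show ?thesis using assms q_sparse_step by (auto simp: Suc)
qed

lemma expected_lyapunov_le:
  "measure_pmf.expectation (dspdc A \<phi> g \<theta> \<tau> \<sigma> m q x0 y0 t) lyapunov \<le> \<rho> ^ t * lyapunov (x0, y0, x0)"
proof (induction t)
  case (Suc t)
  let ?P = "dspdc A \<phi> g \<theta> \<tau> \<sigma> m q x0 y0 t"
  have "measure_pmf.expectation (dspdc A \<phi> g \<theta> \<tau> \<sigma> m q x0 y0 (Suc t)) lyapunov
      \<le> measure_pmf.expectation ?P (\<lambda>s. \<rho> * lyapunov s)"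
    unfolding expectation_dspdc_Suc
  proof (rule expectation_mono_finite[OF finite_set_pmf_dspdc])
    fix s assume "s \<in> set_pmf ?P"
    then have "q_sparse s" by (rule q_sparse_dspdc)
    then show "measure_pmf.expectation (pmf_of_set {I. card I = m}) (\<lambda>I.
      measure_pmf.expectation (pmf_of_set {J. card J = q}) (\<lambda>J.
        lyapunov (dspdc_step A \<phi> g \<theta> \<tau> \<sigma> m I J s))) \<le> \<rho> * lyapunov s"
      using expected_lyapunov_step by (cases s) auto
  qed
  also have "\<dots> = \<rho> * measure_pmf.expectation ?P lyapunov" by simp
  also have "\<dots> \<le> \<rho> * (\<rho> ^ t * lyapunov (x0, y0, x0))"
    using Suc \<rho> by (intro mult_left_mono) auto
  finally show ?case by (simp add: mult.assoc)
qed simp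

lemma linear_convergence:
  "(p / (2 * q * \<tau>) + p * lam / q) *
     measure_pmf.expectation (dspdc A \<phi> g \<theta> \<tau> \<sigma> m q x0 y0 t) (\<lambda>(x, y, xbar). (norm (xs - x))\<^sup>2)
   + (n / (4 * m * \<sigma>) + \<gamma> / m) *
     measure_pmf.expectation (dspdc A \<phi> g \<theta> \<tau> \<sigma> m q x0 y0 t) (\<lambda>(x, y, xbar). (norm (ys - y))\<^sup>2)
   \<le> \<rho> ^ t * ((p / (2 * q * \<tau>) + p * lam / q) * (norm (xs - x0))\<^sup>2
       + (n / (2 * m * \<sigma>) + \<gamma> / m) * (norm (ys - y0))\<^sup>2)"
  (is "?a * _ + ?b * _ \<le> _")
proof -
  let ?P = "dspdc A \<phi> g \<theta> \<tau> \<sigma> m q x0 y0 t"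
  have int: "integrable (measure_pmf ?P) f" for f :: "_ \<Rightarrow> real"
    by (rule integrable_measure_pmf_finite[OF finite_set_pmf_dspdc])
  have "?a * measure_pmf.expectation ?P (\<lambda>(x, y, xbar). (norm (xs - x))\<^sup>2)
      + ?b * measure_pmf.expectation ?P (\<lambda>(x, y, xbar). (norm (ys - y))\<^sup>2)
      = measure_pmf.expectation ?P (\<lambda>s. ?a * (case s of (x, y, xbar) \<Rightarrow> (norm (xs - x))\<^sup>2)
          + ?b * (case s of (x, y, xbar) \<Rightarrow> (norm (ys - y))\<^sup>2))"
    by (simp only: Bochner_Integration.integral_add[OF int int] integral_mult_right_zero)
  also have "\<dots> \<le> measure_pmf.expectation ?P lyapunov"
    by (rule expectation_mono_finite[OF finite_set_pmf_dspdc])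
      (use lyapunov_ge q_sparse_dspdc in \<open>auto split: prod.split\<close>)
  also have "\<dots> \<le> \<rho> ^ t * lyapunov (x0, y0, x0)"
    by (rule expected_lyapunov_le)
  \<comment> \<open>The coupling vanishes at the start because the initial increment is
    zero.\<close>
  also have "lyapunov (x0, y0, x0) = ?a * (norm (xs - x0))\<^sup>2
       + (n / (2 * m * \<sigma>) + \<gamma> / m) * (norm (ys - y0))\<^sup>2"
    by (simp add: lyapunov_def coupling_def)
  finally show ?thesis .
qed

end

section \<open>The prescribed parameters and the resulting rate\<close>

theorem theorem1:
  fixes A :: "real^'p::finite^'n::finite"
    and \<phi> :: "'n \<Rightarrow> real \<Rightarrow> real" and g :: "'p \<Rightarrow> real \<Rightarrow> real"
    and lam \<gamma> \<Lambda> \<theta> \<tau> \<sigma> n p :: real and m q t :: nat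
    and x0 xs :: "real^'p" and y0 ys :: "real^'n"
  defines "n \<equiv> real CARD('n)" and "p \<equiv> real CARD('p)"
  assumes "lam > 0" and "\<gamma> > 0"
    and "\<And>j. strongly_convex lam (g j)"
    and "\<And>i. convex_on UNIV (\<phi> i)"
    and "\<And>i. smooth_with (1 / \<gamma>) (\<phi> i)"
    and "is_arg_min (primal_obj A \<phi> g) (\<lambda>_. True) xs"
    and "is_arg_max (dual_obj A \<phi> g) (\<lambda>_. True) ys"
    and "m \<in> {1..CARD('n)}" and "q \<in> {1..CARD('p)}"
    and "\<Lambda> > 0" and "\<Lambda> \<ge> max_block_norm_sq A q m"
    and "\<tau> > 0" and "\<sigma> > 0"
    and "\<theta> = p / q - (p / q) / (sqrt (\<Lambda> / (lam * \<gamma> * n)) * (n * p / (m * q)) + max (n / m) (p / q))"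
    and "\<tau> * \<sigma> = n * m * q / (4 * p * \<Lambda>)"
    and "p / (2 * q * lam * \<tau>) + p / q = n\<^sup>2 / (2 * m * \<gamma> * \<sigma>) + n / m"
  shows "(p / (2 * q * \<tau>) + p * lam / q) *
           measure_pmf.expectation (dspdc A \<phi> g \<theta> \<tau> \<sigma> m q x0 y0 t) (\<lambda>(x, y, xbar). (norm (xs - x))\<^sup>2)
         + (n / (4 * m * \<sigma>) + \<gamma> / m) *
           measure_pmf.expectation (dspdc A \<phi> g \<theta> \<tau> \<sigma> m q x0 y0 t) (\<lambda>(x, y, xbar). (norm (ys - y))\<^sup>2)
       \<le> (1 - 1 / (max (p / q) (n / m) + sqrt (\<Lambda> / (lam * \<gamma> * n)) * (n * p / (m * q)))) ^ t *
           ((p / (2 * q * \<tau>) + p * lam / q) * (norm (xs - x0))\<^sup>2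
            + (n / (2 * m * \<sigma>) + \<gamma> / m) * (norm (ys - y0))\<^sup>2)"
proof -
  have pos: "n > 0" "p > 0" "real m > 0" "real q > 0" "1 \<le> p / q"
    using assms(10,11) by (auto simp: n_def p_def)
  define S where "S = sqrt (\<Lambda> / (lam * \<gamma> * n)) * (n * p / (m * q))"
  define K where "K = max (p / q) (n / m) + S"
  define \<rho> where "\<rho> = 1 - 1 / K"
  \<comment> \<open>In these terms the balance condition reads \<open>r + p / q = s + n / m\<close>,
    and the condition on \<open>\<tau> * \<sigma>\<close> becomes
    \<open>r * s = S\<^sup>2\<close>.\<close>
  define r s where "r = p / (2 * q * lam * \<tau>)" and "s = n\<^sup>2 / (2 * m * \<gamma> * \<sigma>)"
  have "S > 0"
    using pos assms(3,4,12) by (simp add: S_def)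
  \<comment> \<open>This makes \<open>\<rho>\<close>, and with it \<open>\<theta>\<close>, positive,
    so dividing by \<open>\<theta>\<close> in \<open>lyapunov\<close> recovers the
    increment.\<close>
  then have "K > 1" using pos(5) by (simp add: K_def)
  have \<rho>: "0 < \<rho>" "\<rho> \<le> 1"
    using \<open>K > 1\<close> by (simp_all add: \<rho>_def)
  have \<Lambda>: "\<Lambda> = n * m * q / (4 * p * (\<tau> * \<sigma>))"
    using assms(12,17) pos assms(14,15) by (simp add: field_simps)
  have "S\<^sup>2 = \<Lambda> / (lam * \<gamma> * n) * (n * p / (m * q))\<^sup>2"
    unfolding S_def power_mult_distrib using pos assms(3,4,12) by simp
  also have "\<dots> = r * s"
    unfolding \<Lambda> r_def s_def using pos assms(3,4,14,15) by (simp add: field_simps power2_eq_square)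
  finally have rs: "r * s = S\<^sup>2" ..
  have "r + p / q \<le> K"
    unfolding K_def
  proof (rule balanced_sum_le[where s = s])
    show "r > 0" "s > 0"
      using pos assms(3,4,14,15) by (simp_all add: r_def s_def)
    show "r + p / q = s + n / m"
      unfolding r_def s_def by (rule assms(18))
  qed (use \<open>S > 0\<close> rs in auto)
  then have "s + n / m \<le> K"
    using assms(18) by (simp add: r_def s_def)
  interpret dspdc_setting A \<phi> g lam \<gamma> \<Lambda> \<theta> \<tau> \<sigma> n p \<rho> m q xs ys
  proof
    show ys: "ys $ i = deriv (\<phi> i) (row i A \<bullet> xs)" for i
      by (rule saddle_point_dual[OF assms(3,5,6,7,8,9)])
    show "1 / n * (column j A \<bullet> ys) * xs $ j + g j (xs $ j)
        \<le> 1 / n * (column j A \<bullet> ys) * \<alpha> + g j \<alpha>" for j \<alpha>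
    proof (rule primal_minimizer_coordinatewise[OF assms(3,5,7) _ ys])
      show "primal_obj A \<phi> g xs \<le> primal_obj A \<phi> g x" for x
        using assms(8) by (simp add: is_arg_min_linorder)
    qed (simp add: n_def)
    show "\<theta> = \<rho> * (p / q)"
    proof -
      have "\<theta> = p / q - (p / q) / K"
        unfolding K_def S_def by (subst assms(16)) (simp only: max.commute add.commute)
      then show ?thesis by (simp add: \<rho>_def algebra_simps)
    qed
    \<comment> \<open>Multiplying the two sides of the balance condition by \<open>lam\<close> and
      \<open>\<gamma> / n\<close> gives the Lyapunov weights; since
      \<open>1 - \<rho> = 1 / K\<close>, the bound by \<open>K\<close> is the required rate.\<close>
    have "p / (2 * q * \<tau>) + p * lam / q = lam * (r + p / q)"
      using pos assms(3,14) by (simp add: r_def field_simps)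
    also have "\<dots> \<le> lam * K"
      using \<open>r + p / q \<le> K\<close> assms(3) by simp
    finally show "(1 - \<rho>) * (p / (2 * q * \<tau>) + p * lam / q) \<le> lam"
      using \<open>K > 1\<close> by (simp add: \<rho>_def pos_divide_le_eq)
    have "n / (2 * m * \<sigma>) + \<gamma> / m = \<gamma> / n * (s + n / m)"
      using pos assms(4,15) by (simp add: s_def field_simps power2_eq_square)
    also have "\<dots> \<le> \<gamma> / n * K"
      using \<open>s + n / m \<le> K\<close> assms(4) pos(1) by (intro mult_left_mono) auto
    finally show "(1 - \<rho>) * (n / (2 * m * \<sigma>) + \<gamma> / m) \<le> \<gamma> / n"
      using \<open>K > 1\<close> by (simp add: \<rho>_def pos_divide_le_eq)
  qed (use assms \<rho> in auto)
  show ?thesis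
    using linear_convergence[of x0 y0 t] unfolding \<rho>_def K_def S_def .
qed

end
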